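(* Consider the problem $\min_{x\in\mathbb{R}^{d_x}}\{F(x):=\max_{y\in\mathcal{Y}}\phi(x,y)\}$ under the standing assumptions (i)–(iv) listed in the context, and let $\epsilon>0$. Suppose that the parameters $\gamma,\eta_0,\eta_1$ of the SMAG algorithm for weakly-convex-strongly-concave min-max optimization (described in the context) are chosen as follows: $$0<\gamma<\delta_\phi^{-1},\quad \alpha=\min\Big\{\tfrac{1/\gamma-\delta_\phi}{2},\mu_\phi\Big\},\quad \tau=\min\Big\{\tfrac{\gamma^2\alpha^2}{4},\tfrac{\mu_\phi^{1.5}\gamma^2\alpha^{1.5}}{4L_{\phi,yx}}\Big\},\quad \nu=\min\Big\{1,\tfrac{2\tau}{\gamma^2\alpha}\Big\},$$ $$\eta_1=\min\Big\{\tfrac{\gamma^2(1/\gamma-\delta_\phi)}{2},\tfrac{1}{2L_F\tau},\tfrac{\min\{1,\gamma^2\}\min\{\alpha,\tau\}\nu\alpha}{384\,\tau M^2}\epsilon^2\Big\},\qquad \eta_0=\tau\eta_1,$$ where $L_F=\frac{2}{\gamma}$. Let $$P_0=\frac{2\eta_0}{\eta_1\gamma^2\alpha}\Big(\mathbb{E}\|x_\phi^1-\mathrm{prox}_{\gamma F}(x_0)\|^2+\mathbb{E}\|y_1-y_0^*\|^2\Big),\qquad y_0^*=y^*(\mathrm{prox}_{\gamma F}(x_0)).$$ Then, whenever $$T\ge\frac{16\,(F_\gamma(x_0)-F_\gamma^*+P_0)}{\min\{1,\gamma^{-2}\}\min\{\alpha,\tau\}\,\nu\,\epsilon^2}\max\Big\{\tfrac{2}{\gamma^2(1/\gamma-\delta_\phi)},2L_F\tau,\tfrac{384\,\tau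 M^2}{\min\{1,\gamma^2\}\min\{\alpha,\tau\}\nu\alpha\epsilon^2}\Big\},$$ we have $$\frac1T\sum_{t=0}^{T-1}\Big(\mathbb{E}\|x_\phi^{t+1}-\mathrm{prox}_{\gamma F}(x_t)\|^2+\mathbb{E}\|\nabla F_\gamma(x_t)\|^2\Big)\le\min\{1,\gamma^{-2}\}\frac{\epsilon^2}{4},$$ and consequently, with $\bar t$ sampled uniformly from $\{0,\dots,T-1\}$, the output $x_{\bar t}$ is a nearly $\epsilon$-critical point of the problem.
   Context: Setting. $\mathcal{Y}\subset\mathbb{R}^{d_y}$ is convex and compact; $\phi(x,y)=\mathbb{E}_\xi[\phi(x,y;\xi)]$. Write $y^*(x)=\arg\max_{y\in\mathcal{Y}}\phi(x,y)$. $\|\cdot\|$ is the Euclidean norm and $P_{\mathcal{Y}}$ is Euclidean projection onto $\mathcal{Y}$. Definitions. A vector $v$ is a subgradient of $f$ at $x$ (with $f(x)$ finite) if $f(y)\ge f(x)+\langle v,y-x\rangle+o(\|y-x\|)$ as $y\to x$; $\partial f(x)$ is the set of all subgradients. $f$ is $\delta$-weakly convex if $f(\cdot)+\frac{\delta}{2}\|\cdot\|^2$ is convex. For a $\delta$-weakly convex $f$ and $\gamma\in(0,\delta^{-1})$, the Moreau envelope and proximal map are $f_\gamma(x)=\min_{x'}\{f(x')+\frac1{2\gamma}\|x'-x\|^2\}$ and $\mathrm{prox}_{\gamma f}(x)=\arg\min_{x'}\{f(x')+\frac1{2\gamma}\|x'-x\|^2\}$. $F_\gamma$ is the Moreau envelope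 of $F$. A (random) vector $x$ is a nearly $\epsilon$-critical point of $\min_x\{\Phi(x)-\Psi(x)\}$ if there exist (random) $v,x',x''$ with $v\in\partial\Phi(x')-\partial\Psi(x'')$ and $\max\{\mathbb{E}\|v\|,\mathbb{E}\|x-x'\|,\mathbb{E}\|x-x''\|\}\le\epsilon$. Here it is applied with $\Phi=F$ and $\Psi\equiv0$; equivalently (taking $x''=x$), there exist (random) $x'$ and $v\in\partial F(x')$ with $\mathbb{E}\|v\|\le\epsilon$ and $\mathbb{E}\|x-x'\|\le\epsilon$, i.e. $x$ is within $\epsilon$ (in expectation) of an $\epsilon$-stationary point of $F$. Standing assumptions. (i) $\phi(\cdot,y)$ is $\delta_\phi$-weakly convex for each $y\in\mathcal Y$ and $\phi(x,\cdot)$ is $\mu_\phi$-strongly concave for each $x$. (ii) $\phi(x,y)$ is differentiable in $y$, and $\nabla_y\phi(\cdot,y)$ is $L_{\phi,yx}$-Lipschitz continuous. (iii) There is a constant $F_\gamma^*>-\infty$ with $F_\gamma^*\le F_\gamma(x)$ for all $x$. (iv) There is a finite constant $M$ such that $\mathbb{E}\|\tilde\partial_x\phi(x,y)\|^2\le M^2$ and $\mathbb{E}\|\tilde\nabla_y\phi(x,y)\|^2\le M^2$ for all $x\in\mathbb{R}^{d_x}$, $y\in\mathcal{Y}$. Here $\tilde\partial_x\phi(x,y)$ denotes an unbiased stochastic estimator of a subgradient of $\phi(\cdot,y)$ at $x$ and $\tilde\nabla_y\phi(x,y)$ an unbiased stochastic estimator of $\nabla_y\phi(x,y)$ (in the algorithm,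 unbiasedness and moment bounds hold conditionally on the past iterates). SMAG algorithm for weakly-convex-strongly-concave min-max optimization. Given initial points $x_\phi^0,x_0\in\mathbb{R}^{d_x}$, $y_0\in\mathcal Y$ and parameters $\gamma,\eta_0,\eta_1>0$, for $t=0,\dots,T-1$: $x_\phi^{t+1}=x_\phi^t-\eta_1\big(\tilde\partial_x\phi(x_\phi^t,y_t)+\frac1\gamma(x_\phi^t-x_t)\big)$; $y_{t+1}=P_{\mathcal{Y}}\big(y_t+\eta_1\tilde\nabla_y\phi(x_\phi^t,y_t)\big)$; $G_{t+1}=\frac1\gamma(x_t-x_\phi^{t+1})$; $x_{t+1}=x_t-\eta_0G_{t+1}$. It returns $x_{\bar t}$ with $\bar t$ uniformly sampled from $\{0,\dots,T-1\}$. *)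

theory Defs
  imports "HOL-Probability.Probability" "HOL-Library.Landau_Symbols"
begin

definition subdifferential :: "('a::real_inner \<Rightarrow> real) \<Rightarrow> 'a \<Rightarrow> 'a set" where
  "subdifferential f x =
     {v. \<exists>r \<in> o[at x](\<lambda>y. norm (y - x)).
           \<forall>\<^sub>F y in at x. f y \<ge> f x + v \<bullet> (y - x) + r y}"

definition weakly_convex :: "real \<Rightarrow> ('a::real_inner \<Rightarrow> real) \<Rightarrow> bool" where
  "weakly_convex \<delta> f \<longleftrightarrow> convex_on UNIV (\<lambda>x. f x + \<delta> / 2 * (norm x)\<^sup>2)"

definition strongly_concave_on :: "real \<Rightarrow> 'a::real_inner set \<Rightarrow> ('a \<Rightarrow> real) \<Rightarrow> bool" where
  "strongly_concave_on \<mu> S f \<longleftrightarrow> concave_on S (\<lambda>y. f y + \<mu> / 2 * (norm y)\<^sup>2)"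

text \<open>For a weakly convex \<open>f\<close> with parameter \<open>\<delta>\<close> and \<open>0 < \<gamma> < 1 / \<delta>\<close> the infimum is attained,
  at a unique point.\<close>

definition moreau_env :: "real \<Rightarrow> ('a::real_inner \<Rightarrow> real) \<Rightarrow> 'a \<Rightarrow> real" where
  "moreau_env \<gamma> f x = (INF x'. f x' + 1 / (2 * \<gamma>) * (norm (x' - x))\<^sup>2)"

definition prox :: "real \<Rightarrow> ('a::real_inner \<Rightarrow> real) \<Rightarrow> 'a \<Rightarrow> 'a" where
  "prox \<gamma> f x = arg_min (\<lambda>x'. f x' + 1 / (2 * \<gamma>) * (norm (x' - x))\<^sup>2) (\<lambda>_. True)"

definition gradient :: "('a::real_inner \<Rightarrow> real) \<Rightarrow> 'a \<Rightarrow> 'a" where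
  "gradient f x = (THE D. GDERIV f x :> D)"

text \<open>For compact nonempty \<open>Y\<close> and continuous \<open>\<phi> x\<close> the supremum is a maximum.\<close>

definition max_fun :: "'b set \<Rightarrow> ('a \<Rightarrow> 'b \<Rightarrow> real) \<Rightarrow> 'a \<Rightarrow> real" where
  "max_fun Y \<phi> x = (SUP y\<in>Y. \<phi> x y)"

definition y_star :: "'b set \<Rightarrow> ('a \<Rightarrow> 'b \<Rightarrow> real) \<Rightarrow> 'a \<Rightarrow> 'b" where
  "y_star Y \<phi> x = arg_max (\<phi> x) (\<lambda>y. y \<in> Y)"

text \<open>\<open>X\<close> is a random vector on the probability space \<open>N\<close>; its witnesses live on the same space.
  Integrability is demanded since the Bochner integral of a non-integrable function is 0.\<close>

definition nearly_critical ::
  "'w measure \<Rightarrow> ('a::euclidean_space \<Rightarrow> real) \<Rightarrow> ('a \<Rightarrow> real) \<Rightarrow> real \<Rightarrow> ('w \<Rightarrow> 'a) \<Rightarrow> bool" where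
  "nearly_critical N \<Phi> \<Psi> \<epsilon> X \<longleftrightarrow>
     X \<in> borel_measurable N \<and>
     (\<exists>v x' x''.
        v \<in> borel_measurable N \<and> x' \<in> borel_measurable N \<and> x'' \<in> borel_measurable N \<and>
        (\<forall>\<omega>\<in>space N. v \<omega> \<in> {a - b |a b. a \<in> subdifferential \<Phi> (x' \<omega>)
                                     \<and> b \<in> subdifferential \<Psi> (x'' \<omega>)}) \<and>
        integrable N (\<lambda>\<omega>. norm (v \<omega>)) \<and>
        integrable N (\<lambda>\<omega>. norm (X \<omega> - x' \<omega>)) \<and>
        integrable N (\<lambda>\<omega>. norm (X \<omega> - x'' \<omega>)) \<and>
        Max {\<integral>\<omega>. norm (v \<omega>) \<partial>N, \<integral>\<omega>. norm (X \<omega> - x' \<omega>) \<partial>N, \<integral>\<omega>. norm (X \<omega> - x'' \<omega>) \<partial>N} \<le> \<epsilon>)"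

text \<open>The library's conditional expectation is real-valued; this is its coordinatewise extension.\<close>

definition vec_cond_exp ::
  "'w measure \<Rightarrow> 'w measure \<Rightarrow> ('w \<Rightarrow> 'a::euclidean_space) \<Rightarrow> 'w \<Rightarrow> 'a" where
  "vec_cond_exp P H g \<omega> = (\<Sum>b\<in>Basis. real_cond_exp P H (\<lambda>\<omega>. g \<omega> \<bullet> b) \<omega> *\<^sub>R b)"

text \<open>The sigma-algebra generated by \<open>Z 0, \<dots>, Z t\<close>.\<close>

definition history :: "'w measure \<Rightarrow> (nat \<Rightarrow> 'w \<Rightarrow> 'z::topological_space) \<Rightarrow> nat \<Rightarrow> 'w measure" where
  "history P Z t = sigma (space P) {Z s -` A \<inter> space P |s A. s \<le> t \<and> A \<in> sets borel}"

text \<open>\<open>g\<close> is a random vector with mean in \<open>S\<close> and second moment at most \<open>M\<^sup>2\<close>.  The second moment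
  is an extended nonnegative integral, so its finiteness is part of the bound.\<close>

definition estimator_of ::
  "'w measure \<Rightarrow> real \<Rightarrow> ('w \<Rightarrow> 'a::euclidean_space) \<Rightarrow> 'a set \<Rightarrow> bool" where
  "estimator_of P M g S \<longleftrightarrow>
     g \<in> borel_measurable P \<and>
     (\<integral>\<omega>. g \<omega> \<partial>P) \<in> S \<and>
     (\<integral>\<^sup>+\<omega>. ennreal ((norm (g \<omega>))\<^sup>2) \<partial>P) \<le> ennreal (M\<^sup>2)"

text \<open>The same conditionally on \<open>H\<close>, where the target set may itself be random.\<close>

definition cond_estimator_of ::
  "'w measure \<Rightarrow> 'w measure \<Rightarrow> real \<Rightarrow> ('w \<Rightarrow> 'a::euclidean_space) \<Rightarrow> ('w \<Rightarrow> 'a set) \<Rightarrow> bool" where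
  "cond_estimator_of P H M g S \<longleftrightarrow>
     g \<in> borel_measurable P \<and>
     (AE \<omega> in P. vec_cond_exp P H g \<omega> \<in> S \<omega>) \<and>
     (AE \<omega> in P. nn_cond_exp P H (\<lambda>\<omega>. ennreal ((norm (g \<omega>))\<^sup>2)) \<omega> \<le> ennreal (M\<^sup>2))"

text \<open>\<open>gx t x y\<close> and \<open>gy t x y\<close> are the stochastic estimators, as drawn in iteration \<open>t\<close>, of a
  subgradient of \<open>\<phi>(\<cdot>, y)\<close> at \<open>x\<close> and of the \<open>y\<close>-gradient at \<open>(x, y)\<close>.\<close>

definition smag_run ::
  "'w measure \<Rightarrow> 'b::euclidean_space set \<Rightarrow>
   (nat \<Rightarrow> 'a::euclidean_space \<Rightarrow> 'b \<Rightarrow> 'w \<Rightarrow> 'a) \<Rightarrow> (nat \<Rightarrow> 'a \<Rightarrow> 'b \<Rightarrow> 'w \<Rightarrow> 'b) \<Rightarrow>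
   real \<Rightarrow> real \<Rightarrow> real \<Rightarrow> nat \<Rightarrow> 'a \<Rightarrow> 'a \<Rightarrow> 'b \<Rightarrow>
   (nat \<Rightarrow> 'w \<Rightarrow> 'a) \<Rightarrow> (nat \<Rightarrow> 'w \<Rightarrow> 'a) \<Rightarrow> (nat \<Rightarrow> 'w \<Rightarrow> 'b) \<Rightarrow> (nat \<Rightarrow> 'w \<Rightarrow> 'a) \<Rightarrow> bool" where
  "smag_run P Y gx gy \<gamma> \<eta>0 \<eta>1 T x\<phi>0 x0 y0 x\<phi> x y G \<longleftrightarrow>
     (\<forall>\<omega>\<in>space P.
        x\<phi> 0 \<omega> = x\<phi>0 \<and> x 0 \<omega> = x0 \<and> y 0 \<omega> = y0 \<and>
        (\<forall>t<T.
           x\<phi> (Suc t) \<omega> = x\<phi> t \<omega> - \<eta>1 *\<^sub>R (gx t (x\<phi> t \<omega>) (y t \<omega>) \<omega> + (1 / \<gamma>) *\<^sub>R (x\<phi> t \<omega> - x t \<omega>)) \<and>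
           y (Suc t) \<omega> = closest_point Y (y t \<omega> + \<eta>1 *\<^sub>R gy t (x\<phi> t \<omega>) (y t \<omega>) \<omega>) \<and>
           G (Suc t) \<omega> = (1 / \<gamma>) *\<^sub>R (x t \<omega> - x\<phi> (Suc t) \<omega>) \<and>
           x (Suc t) \<omega> = x t \<omega> - \<eta>0 *\<^sub>R G (Suc t) \<omega>))"

end

theory Submission
  imports Defs
begin

text \<open>
  For a fixed slow iterate \<open>x\<close>, the regularized function
  \<open>\<psi>(u, y) = \<phi> u y + (1 / (2 * \<gamma>)) * (norm (u - x))\<^sup>2\<close> is strongly convex in \<open>u\<close>, with modulus
  \<open>\<rho> = 1 / \<gamma> - \<delta>\<close>, and strongly concave in \<open>y\<close>, with modulus \<open>\<mu>\<close>.  Its saddle point consists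
  of the proximal point \<open>pr x\<close> of \<open>F\<close> and of the maximizer \<open>ys (pr x)\<close> (\<open>saddle_point\<close>).  The
  algorithm makes one stochastic gradient descent ascent step on \<open>\<psi>\<close> and then moves \<open>x\<close> along
  \<open>G = (x - x\<phi>) / \<gamma>\<close>, which approximates the gradient \<open>(x - pr x) / \<gamma>\<close> of the Moreau
  envelope with error exactly \<open>(x\<phi> - pr x) / \<gamma>\<close>.

  Three estimates are combined.

  \<^item> The envelope is an infimum of quadratics of curvature \<open>1 / \<gamma>\<close>, hence decreases along \<open>G\<close> by
  a multiple of \<open>(norm (\<nabla> F\<^sub>\<gamma>))\<^sup>2 + (norm G)\<^sup>2\<close>, up to the squared error of \<open>x\<phi>\<close> (\<open>env_descent\<close>).

  \<^item> Strong monotonicity of the saddle operator of \<open>\<psi>\<close> makes the squared distance of the fast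
  iterates to the saddle point contract in conditional mean, up to a noise term \<open>9 * \<eta>1\<^sup>2 * M\<^sup>2\<close>
  (\<open>one_step\<close>).  The noise is bounded although the gradient of the quadratic term is not: at the
  saddle point that gradient is balanced by a subgradient of norm at most \<open>M\<close>
  (\<open>env_grad_bound\<close>), and what is left over is proportional to the distance to the saddle point.

  \<^item> When \<open>x\<close> moves, the saddle point moves by a multiple of \<open>\<eta>0 * norm G\<close>, since \<open>pr\<close> and
  \<open>ys\<close> are Lipschitz (\<open>drift\<close>).

  With \<open>c = 2 * \<tau> / (\<gamma>\<^sup>2 * \<alpha>)\<close>, the smallness of \<open>\<tau> = \<eta>0 / \<eta>1\<close> lets the descent term in
  \<open>(norm G)\<^sup>2\<close> absorb the drift, so that envelope plus \<open>c\<close> times the expected squared distance is a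
  Lyapunov function up to noise (\<open>lyapunov_bound\<close>).  The choice of \<open>\<eta>1\<close> and \<open>T\<close> makes what
  remains at most the required accuracy (\<open>average_le_accuracy\<close>).  For near criticality the
  witnesses are the proximal point of the random iterate and the envelope gradient there, which is a
  subgradient of \<open>F\<close> at that proximal point.
\<close>

section \<open>Weak convexity and strong concavity along segments\<close>

lemma norm_sq_segment:
  fixes a b c :: "'a::real_inner"
  shows "(norm (a + s *\<^sub>R (b - a) - c))\<^sup>2
    = (1 - s) * (norm (a - c))\<^sup>2 + s * (norm (b - c))\<^sup>2 - s * (1 - s) * (norm (b - a))\<^sup>2"
  unfolding power2_norm_eq_inner
  by (simp add: inner_diff_left inner_diff_right inner_add_left inner_add_right inner_commute algebra_simps)

lemma segment_eq: "a + s *\<^sub>R (b - a) = (1 - s) *\<^sub>R a + s *\<^sub>R (b::'a::real_vector)"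
  by (simp add: algebra_simps)

lemma weakly_convex_segment:
  fixes f :: "'a::real_inner \<Rightarrow> real"
  assumes "weakly_convex \<delta> f" "0 \<le> s" "s \<le> 1"
  shows "f (a + s *\<^sub>R (b - a)) \<le> (1 - s) * f a + s * f b + \<delta> / 2 * (s * (1 - s) * (norm (b - a))\<^sup>2)"
proof -
  define h where "h = \<delta> / 2"
  have "f (a + s *\<^sub>R (b - a)) + h * (norm (a + s *\<^sub>R (b - a)))\<^sup>2
     \<le> (1 - s) * (f a + h * (norm a)\<^sup>2) + s * (f b + h * (norm b)\<^sup>2)"
    using assms convex_onD[of UNIV "\<lambda>x. f x + \<delta> / 2 * (norm x)\<^sup>2" s a b]
    unfolding weakly_convex_def segment_eq h_def by simp
  then show ?thesis
    unfolding h_def[symmetric] norm_sq_segment[of a s b 0, simplified] by (simp add: algebra_simps)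
qed

lemma strongly_concave_segment:
  fixes f :: "'a::real_inner \<Rightarrow> real"
  assumes "strongly_concave_on \<mu> S f" "a \<in> S" "b \<in> S" "0 \<le> s" "s \<le> 1"
  shows "f (a + s *\<^sub>R (b - a)) \<ge> (1 - s) * f a + s * f b + \<mu> / 2 * (s * (1 - s) * (norm (b - a))\<^sup>2)"
proof -
  define h where "h = \<mu> / 2"
  have "f (a + s *\<^sub>R (b - a)) + h * (norm (a + s *\<^sub>R (b - a)))\<^sup>2
     \<ge> (1 - s) * (f a + h * (norm a)\<^sup>2) + s * (f b + h * (norm b)\<^sup>2)"
    using assms convex_onD[of S "\<lambda>x. - (f x + \<mu> / 2 * (norm x)\<^sup>2)" s a b]
    unfolding strongly_concave_on_def concave_on_def segment_eq h_def by (simp add: algebra_simps)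
  then show ?thesis
    unfolding h_def[symmetric] norm_sq_segment[of a s b 0, simplified] by (simp add: algebra_simps)
qed

lemma eventually_at_right_unit: "\<forall>\<^sub>F s in at_right (0::real). 0 < s \<and> s < 1"
  by (auto simp: eventually_at_right_field intro: exI[of _ 1])

text \<open>Every first-order inequality below comes from comparing a function at the two ends of a segment with
its value at parameter \<open>s\<close> near \<open>0\<close>.  After division by \<open>s\<close> there remain a slack \<open>e\<close>, from the
little-o term of a derivative or subgradient, and a term \<open>k * s\<close>, from the modulus of convexity.\<close>

lemma le_of_eventually_le_linear:
  fixes q r k :: real
  assumes "\<And>e. e > 0 \<Longrightarrow> \<forall>\<^sub>F s in at_right 0. q \<le> r + e + k * s"
  shows "q \<le> r"
proof (rule field_le_epsilon)
  fix e :: real assume e: "e > 0"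
  have "((\<lambda>s::real. r + e + k * s) \<longlongrightarrow> r + e + k * 0) (at_right 0)"
    by (intro tendsto_intros)
  then show "q \<le> r + e"
    using tendsto_lowerbound[OF _ assms[OF e]] by simp
qed

text \<open>For a weakly convex function the local subgradient inequality becomes global, at the cost of the
quadratic term: on the segment from \<open>x\<close> to \<open>z\<close> the convexity defect is at most
\<open>\<delta> / 2 * s * (1 - s) * (norm (z - x))\<^sup>2\<close>.\<close>

lemma weakly_convex_subgradient_ineq:
  fixes f :: "'a::real_inner \<Rightarrow> real"
  assumes wc: "weakly_convex \<delta> f" and v: "v \<in> subdifferential f x"
  shows "f z \<ge> f x + v \<bullet> (z - x) - \<delta> / 2 * (norm (z - x))\<^sup>2"
proof (cases "z = x")
  case False
  define n where "n = norm (z - x)"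
  have n: "n > 0" using False by (simp add: n_def)
  obtain r where r: "r \<in> o[at x](\<lambda>y. norm (y - x))"
    and fr: "\<forall>\<^sub>F y in at x. f y \<ge> f x + v \<bullet> (y - x) + r y"
    using v unfolding subdifferential_def by blast
  have lim: "filterlim (\<lambda>s. x + s *\<^sub>R (z - x)) (at x) (at_right (0::real))"
    unfolding filterlim_at
  proof
    show "\<forall>\<^sub>F s in at_right 0. x + s *\<^sub>R (z - x) \<in> UNIV \<and> x + s *\<^sub>R (z - x) \<noteq> x"
      using eventually_at_right_unit by eventually_elim (use False in auto)
    have "((\<lambda>s::real. x + s *\<^sub>R (z - x)) \<longlongrightarrow> x + 0 *\<^sub>R (z - x)) (at_right 0)"
      by (intro tendsto_intros)
    then show "((\<lambda>s::real. x + s *\<^sub>R (z - x)) \<longlongrightarrow> x) (at_right 0)" by simp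
  qed
  have "v \<bullet> (z - x) \<le> f z - f x + \<delta> / 2 * n\<^sup>2"
  proof (rule le_of_eventually_le_linear[where k = "- (\<delta> / 2 * n\<^sup>2)"])
    fix e :: real assume e: "e > 0"
    have "\<forall>\<^sub>F y in at x. norm (r y) \<le> (e / n) * norm (norm (y - x))"
      using landau_o.smallD[OF r, of "e / n"] e n by simp
    then have "\<forall>\<^sub>F y in at x. f y \<ge> f x + v \<bullet> (y - x) - (e / n) * norm (y - x)"
      using fr by eventually_elim auto
    then have "\<forall>\<^sub>F s in at_right 0. f (x + s *\<^sub>R (z - x)) \<ge>
       f x + v \<bullet> (x + s *\<^sub>R (z - x) - x) - (e / n) * norm (x + s *\<^sub>R (z - x) - x)"
      using lim unfolding filterlim_iff by blast
    then show "\<forall>\<^sub>F s in at_right 0. v \<bullet> (z - x) \<le> f z - f x + \<delta> / 2 * n\<^sup>2 + e + - (\<delta> / 2 * n\<^sup>2) * s"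
      using eventually_at_right_unit
    proof eventually_elim
      case (elim s)
      have "f (x + s *\<^sub>R (z - x)) \<le> (1 - s) * f x + s * f z + \<delta> / 2 * (s * (1 - s) * n\<^sup>2)"
        using weakly_convex_segment[OF wc] elim unfolding n_def by auto
      moreover have "norm (s *\<^sub>R (z - x)) = s * n" using elim by (simp add: n_def)
      ultimately have "s * (v \<bullet> (z - x)) \<le> s * (f z - f x + \<delta> / 2 * n\<^sup>2 + e + - (\<delta> / 2 * n\<^sup>2) * s)"
        using elim n by (simp add: algebra_simps)
      then show ?case using elim by simp
    qed
  qed
  then show ?thesis by (simp add: n_def)
qed simp

text \<open>If \<open>S\<close> has empty interior, \<open>g\<close> is not determined by the derivative within \<open>S\<close>, but its inner products
with directions that stay in \<open>S\<close> are.  Only these occur in what follows.\<close>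

lemma has_derivative_within_segment:
  fixes f :: "'a::real_inner \<Rightarrow> real"
  assumes f: "(f has_derivative (\<lambda>h. g \<bullet> h)) (at y within S)"
    and S: "convex S" "y \<in> S" "z \<in> S" and e: "e > 0"
  shows "\<forall>\<^sub>F s in at_right 0. \<bar>f (y + s *\<^sub>R (z - y)) - f y - s * (g \<bullet> (z - y))\<bar> \<le> e * s"
proof -
  define n where "n = norm (z - y) + 1"
  have n: "n > 0" unfolding n_def by (smt (verit) norm_ge_zero)
  obtain d where d: "d > 0" and
    fd: "\<And>u. u \<in> S \<Longrightarrow> norm (u - y) < d \<Longrightarrow> \<bar>f u - f y - g \<bullet> (u - y)\<bar> \<le> e / n * norm (u - y)"
    using f[unfolded has_derivative_within_alt, THEN conjunct2, rule_format, of "e / n"] e n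
    by (auto simp: real_norm_def)
  have "\<forall>\<^sub>F s in at_right 0. 0 < s \<and> s < d / n"
    using d n by (auto simp: eventually_at_right_field intro: exI[of _ "d / n"])
  with eventually_at_right_unit show ?thesis
  proof eventually_elim
    case (elim s)
    have "y + s *\<^sub>R (z - y) \<in> S" using S elim unfolding segment_eq by (simp add: convexD)
    moreover have nn: "norm (s *\<^sub>R (z - y)) \<le> s * n" using elim by (simp add: n_def)
    moreover have "s * n < d" using elim n by (simp add: field_simps)
    ultimately have "\<bar>f (y + s *\<^sub>R (z - y)) - f y - s * (g \<bullet> (z - y))\<bar> \<le> e / n * norm (s *\<^sub>R (z - y))"
      using fd[of "y + s *\<^sub>R (z - y)"] by simp
    also have "\<dots> \<le> e / n * (s * n)" using nn e n by (intro mult_left_mono) auto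
    finally show ?case using n by simp
  qed
qed

lemma strongly_concave_gradient_ineq:
  fixes f :: "'a::real_inner \<Rightarrow> real"
  assumes sc: "strongly_concave_on \<mu> S f" and S: "convex S" "y \<in> S" "z \<in> S"
    and f: "(f has_derivative (\<lambda>h. g \<bullet> h)) (at y within S)"
  shows "f z \<le> f y + g \<bullet> (z - y) - \<mu> / 2 * (norm (z - y))\<^sup>2"
proof -
  have "f z - f y + \<mu> / 2 * (norm (z - y))\<^sup>2 \<le> g \<bullet> (z - y)"
  proof (rule le_of_eventually_le_linear[where k = "\<mu> / 2 * (norm (z - y))\<^sup>2"])
    fix e :: real assume "e > 0"
    from has_derivative_within_segment[OF f S this] eventually_at_right_unit
    show "\<forall>\<^sub>F s in at_right 0. f z - f y + \<mu> / 2 * (norm (z - y))\<^sup>2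
            \<le> g \<bullet> (z - y) + e + \<mu> / 2 * (norm (z - y))\<^sup>2 * s"
    proof eventually_elim
      case (elim s)
      have "(1 - s) * f y + s * f z + \<mu> / 2 * (s * (1 - s) * (norm (z - y))\<^sup>2) \<le> f (y + s *\<^sub>R (z - y))"
        using strongly_concave_segment[OF sc S(2,3)] elim by auto
      then have "s * (f z - f y + \<mu> / 2 * (norm (z - y))\<^sup>2)
            \<le> s * (g \<bullet> (z - y) + e + \<mu> / 2 * (norm (z - y))\<^sup>2 * s)"
        using elim(1) by (simp add: algebra_simps)
      then show ?case using elim by simp
    qed
  qed
  then show ?thesis by simp
qed

lemma maximum_variational_ineq:
  fixes f :: "'a::real_inner \<Rightarrow> real"
  assumes S: "convex S" "y \<in> S" "z \<in> S"
    and f: "(f has_derivative (\<lambda>h. g \<bullet> h)) (at y within S)"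
    and max: "\<And>u. u \<in> S \<Longrightarrow> f u \<le> f y"
  shows "g \<bullet> (z - y) \<le> 0"
proof (rule le_of_eventually_le_linear[where k = 0])
  fix e :: real assume "e > 0"
  from has_derivative_within_segment[OF f S this] eventually_at_right_unit
  show "\<forall>\<^sub>F s in at_right 0. g \<bullet> (z - y) \<le> 0 + e + 0 * s"
  proof eventually_elim
    case (elim s)
    have "y + s *\<^sub>R (z - y) \<in> S" using S elim unfolding segment_eq by (simp add: convexD)
    then have "s * (g \<bullet> (z - y)) \<le> s * e" using elim(1) max[of "y + s *\<^sub>R (z - y)"] by (simp add: algebra_simps)
    then show ?case using elim by simp
  qed
qed

text \<open>The proximal objective is strongly convex with modulus \<open>1 / \<gamma> - \<delta>\<close>, so it grows quadratically away
from a minimizer.\<close>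

lemma proximal_growth:
  fixes f :: "'a::real_inner \<Rightarrow> real"
  assumes wc: "weakly_convex \<delta> f"
    and min: "\<And>u. f p + 1 / (2 * \<gamma>) * (norm (p - x))\<^sup>2 \<le> f u + 1 / (2 * \<gamma>) * (norm (u - x))\<^sup>2"
  shows "f p + 1 / (2 * \<gamma>) * (norm (p - x))\<^sup>2 + (1 / \<gamma> - \<delta>) / 2 * (norm (z - p))\<^sup>2
     \<le> f z + 1 / (2 * \<gamma>) * (norm (z - x))\<^sup>2"
proof -
  define Q where "Q u = f u + 1 / (2 * \<gamma>) * (norm (u - x))\<^sup>2" for u
  define k where "k = (1 / \<gamma> - \<delta>) / 2 * (norm (z - p))\<^sup>2"
  define c where "c = 1 / (2 * \<gamma>)"
  define h where "h = \<delta> / 2"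
  have k: "k = (c - h) * (norm (z - p))\<^sup>2"
    unfolding k_def c_def h_def by (simp add: field_simps)
  have "Q p + k \<le> Q z"
  proof (rule le_of_eventually_le_linear[where k = k])
    fix e :: real assume e: "e > 0"
    from eventually_at_right_unit
    show "\<forall>\<^sub>F s in at_right 0. Q p + k \<le> Q z + e + k * s"
    proof eventually_elim
      case (elim s)
      have "Q p \<le> Q (p + s *\<^sub>R (z - p))" using min unfolding Q_def .
      also have "\<dots> \<le> (1 - s) * Q p + s * Q z - s * (1 - s) * k"
        using weakly_convex_segment[OF wc, of s p z] elim
        unfolding Q_def k norm_sq_segment c_def[symmetric] h_def[symmetric]
        by (simp add: algebra_simps)
      finally have "s * (Q p + k) \<le> s * (Q z + k * s)" by (simp add: algebra_simps)
      then show ?case using elim e by simp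
    qed
  qed
  then show ?thesis by (simp add: Q_def k_def)
qed

section \<open>The maximum function and the inner maximizer\<close>

text \<open>The last assumption is what bounded second moments of an unbiased subgradient estimator give
(\<open>estimator_mean_bounded\<close> below).  It makes the functions \<open>\<lambda>x. \<phi> x y\<close> Lipschitz up to a quadratic
term, with the same constant for all \<open>y\<close>.\<close>

locale wcsc_problem =
  fixes Y :: "'b::euclidean_space set"
    and \<phi> :: "'a::euclidean_space \<Rightarrow> 'b \<Rightarrow> real"
    and grad_y :: "'a \<Rightarrow> 'b \<Rightarrow> 'b"
    and \<delta> \<mu> L M :: real
  assumes Y_convex: "convex Y" and Y_compact: "compact Y" and Y_ne: "Y \<noteq> {}"
    and \<delta>_pos: "\<delta> > 0" and \<mu>_pos: "\<mu> > 0"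
    and wc: "\<And>y. y \<in> Y \<Longrightarrow> weakly_convex \<delta> (\<lambda>x. \<phi> x y)"
    and sc: "\<And>x. strongly_concave_on \<mu> Y (\<phi> x)"
    and deriv: "\<And>x y. y \<in> Y \<Longrightarrow> (\<phi> x has_derivative (\<lambda>h. grad_y x y \<bullet> h)) (at y within Y)"
    and grad_lipschitz: "\<And>y. y \<in> Y \<Longrightarrow> L-lipschitz_on UNIV (\<lambda>x. grad_y x y)"
    and subgrad_ex: "\<And>x y. y \<in> Y \<Longrightarrow> \<exists>v \<in> subdifferential (\<lambda>x. \<phi> x y) x. norm v \<le> M"
begin

abbreviation F :: "'a \<Rightarrow> real" where "F \<equiv> max_fun Y \<phi>"
abbreviation ys :: "'a \<Rightarrow> 'b" where "ys \<equiv> y_star Y \<phi>"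

lemma \<phi>_continuous: "continuous_on Y (\<phi> x)"
  using deriv has_derivative_continuous by (fastforce simp: continuous_on_eq_continuous_within)

lemma ys_is_arg_max: "is_arg_max (\<phi> x) (\<lambda>y. y \<in> Y) (ys x)"
proof -
  obtain y where "y \<in> Y" "\<And>z. z \<in> Y \<Longrightarrow> \<phi> x z \<le> \<phi> x y"
    using continuous_attains_sup[OF Y_compact Y_ne \<phi>_continuous] by blast
  then have "is_arg_max (\<phi> x) (\<lambda>y. y \<in> Y) y" by (auto simp: is_arg_max_linorder)
  then show ?thesis unfolding y_star_def arg_max_def by (rule someI)
qed

lemma ys_in: "ys x \<in> Y" and ys_max: "y \<in> Y \<Longrightarrow> \<phi> x y \<le> \<phi> x (ys x)"
  using ys_is_arg_max by (auto simp: is_arg_max_linorder)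

lemma F_eq: "F x = \<phi> x (ys x)"
  unfolding max_fun_def by (rule cSup_eq_maximum) (use ys_in ys_max in auto)

lemma \<phi>_le_F: "y \<in> Y \<Longrightarrow> \<phi> x y \<le> F x"
  using ys_max F_eq by simp

lemma \<phi>_gradient_ineq:
  assumes "y \<in> Y" "z \<in> Y"
  shows "\<phi> x z \<le> \<phi> x y + grad_y x y \<bullet> (z - y) - \<mu> / 2 * (norm (z - y))\<^sup>2"
  using strongly_concave_gradient_ineq[OF sc Y_convex assms deriv[OF assms(1)]] .

lemma ys_variational: "z \<in> Y \<Longrightarrow> grad_y x (ys x) \<bullet> (z - ys x) \<le> 0"
  using maximum_variational_ineq[OF Y_convex ys_in _ deriv[OF ys_in]] ys_max by blast

lemma ys_growth: "y \<in> Y \<Longrightarrow> \<phi> x y \<le> \<phi> x (ys x) - \<mu> / 2 * (norm (y - ys x))\<^sup>2"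
  using \<phi>_gradient_ineq[OF ys_in, of y x x] ys_variational[of y x] by simp

lemma L_nonneg: "L \<ge> 0"
  using grad_lipschitz Y_ne lipschitz_on_nonneg by blast

lemma M_nonneg: "M \<ge> 0"
  using subgrad_ex Y_ne norm_ge_zero by (meson ex_in_conv order_trans)

text \<open>Add strong concavity of \<open>\<phi> x1\<close>, seen from either maximizer, to the variational inequality for the
maximizer at \<open>x2\<close>: this bounds \<open>\<mu>\<close> times the squared distance by the change of the gradient between
\<open>x1\<close> and \<open>x2\<close>, paired with \<open>ys x1 - ys x2\<close>.\<close>

lemma ys_lipschitz: "norm (ys x1 - ys x2) \<le> L / \<mu> * norm (x1 - x2)"
proof -
  define n where "n = norm (ys x1 - ys x2)"
  have "\<mu> * n\<^sup>2 \<le> grad_y x1 (ys x2) \<bullet> (ys x1 - ys x2)"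
    using \<phi>_gradient_ineq[where x = x1, OF ys_in[of x2] ys_in[of x1]] ys_growth[OF ys_in, of x1 x2]
    by (simp add: n_def norm_minus_commute)
  also have "\<dots> \<le> (grad_y x1 (ys x2) - grad_y x2 (ys x2)) \<bullet> (ys x1 - ys x2)"
    using ys_variational[OF ys_in, of x2 x1] by (simp add: inner_diff_left)
  also have "\<dots> \<le> norm (grad_y x1 (ys x2) - grad_y x2 (ys x2)) * n"
    unfolding n_def by (rule norm_cauchy_schwarz)
  also have "\<dots> \<le> L * norm (x1 - x2) * n"
    using lipschitz_onD[OF grad_lipschitz[OF ys_in]] by (intro mult_right_mono) (auto simp: n_def dist_norm)
  finally have "n * (\<mu> * n) \<le> n * (L * norm (x1 - x2))" by (simp add: power2_eq_square algebra_simps)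
  then have "\<mu> * n \<le> L * norm (x1 - x2)"
    using L_nonneg by (cases "n = 0") (auto simp: n_def)
  then show ?thesis using \<mu>_pos by (simp add: n_def field_simps)
qed

lemma ys_continuous: "continuous_on UNIV ys"
proof (rule lipschitz_on_continuous_on)
  show "(L / \<mu>)-lipschitz_on UNIV ys"
    using ys_lipschitz L_nonneg \<mu>_pos by (auto intro!: lipschitz_onI simp: dist_norm)
qed

text \<open>A subgradient of \<open>\<phi>\<close> in \<open>x\<close>, taken at the active \<open>y\<close>, supports \<open>F\<close> from below.  The estimate
gives both the continuity of \<open>F\<close>, by exchanging \<open>x\<close> and \<open>z\<close>, and the coercivity of the proximal
objective.\<close>

lemma F_lower: "F z \<ge> F x - M * norm (z - x) - \<delta> / 2 * (norm (z - x))\<^sup>2"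
proof -
  obtain v where v': "v \<in> subdifferential (\<lambda>u. \<phi> u (ys x)) x" "norm v \<le> M"
    using subgrad_ex[OF ys_in] by blast
  have "v \<bullet> (z - x) \<ge> - (norm v * norm (z - x))"
    using Cauchy_Schwarz_ineq2[of v "z - x"] by linarith
  also have "- (norm v * norm (z - x)) \<ge> - (M * norm (z - x))"
    using v' by (simp add: mult_right_mono)
  finally have "v \<bullet> (z - x) \<ge> - (M * norm (z - x))" .
  then show ?thesis
    using weakly_convex_subgradient_ineq[OF wc[OF ys_in] v'(1), of z] \<phi>_le_F[OF ys_in, of z x] F_eq[of x] by linarith
qed

lemma F_continuous: "continuous_on UNIV F"
proof -
  have "isCont F x" for x
  proof -
    define b where "b z = M * norm (z - x) + \<delta> / 2 * (norm (z - x))\<^sup>2" for z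
    have "\<bar>F z - F x\<bar> \<le> b z" for z
      using F_lower[of x z] F_lower[of z x] by (auto simp: b_def norm_minus_commute)
    moreover have "(b \<longlongrightarrow> M * norm (x - x) + \<delta> / 2 * (norm (x - x))\<^sup>2) (at x)"
      unfolding b_def by (intro tendsto_intros)
    ultimately have "((\<lambda>z. F z - F x) \<longlongrightarrow> 0) (at x)"
      by (intro Lim_null_comparison[where g = b and f = "\<lambda>z. F z - F x"]) simp_all
    then show ?thesis unfolding isCont_def by (rule LIM_zero_cancel)
  qed
  then show ?thesis by (simp add: continuous_at_imp_continuous_on)
qed

end

section \<open>Proximal points, saddle points and the Moreau envelope\<close>

locale wcsc_proximal = wcsc_problem Y \<phi> grad_y \<delta> \<mu> L M
  for Y :: "'b::euclidean_space set" and \<phi> :: "'a::euclidean_space \<Rightarrow> 'b \<Rightarrow> real"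
    and grad_y :: "'a \<Rightarrow> 'b \<Rightarrow> 'b" and \<delta> \<mu> L M :: real +
  fixes \<gamma> :: real
  assumes \<gamma>_pos: "\<gamma> > 0" and \<gamma>_small: "\<gamma> < 1 / \<delta>"
begin

abbreviation pr :: "'a \<Rightarrow> 'a" where "pr \<equiv> prox \<gamma> F"
abbreviation env :: "'a \<Rightarrow> real" where "env \<equiv> moreau_env \<gamma> F"

definition env_grad :: "'a \<Rightarrow> 'a" where
  "env_grad x = (1 / \<gamma>) *\<^sub>R (x - pr x)"

definition \<rho> :: real where "\<rho> = 1 / \<gamma> - \<delta>"

lemma \<rho>_pos: "\<rho> > 0"
  using \<gamma>_small \<gamma>_pos \<delta>_pos unfolding \<rho>_def by (simp add: field_simps)

text \<open>By \<open>F_lower\<close> the objective exceeds its value at \<open>x\<close> outside the ball of radius \<open>2 * M / \<rho>\<close> around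
\<open>x\<close>, so a minimizer on that ball is a global one.\<close>

lemma proximal_objective_attains: 
  "\<exists>p. \<forall>z. F p + 1 / (2 * \<gamma>) * (norm (p - x))\<^sup>2 \<le> F z + 1 / (2 * \<gamma>) * (norm (z - x))\<^sup>2"
proof -
  define Q where "Q z = F z + 1 / (2 * \<gamma>) * (norm (z - x))\<^sup>2" for z
  define R where "R = 2 * M / \<rho>"
  have R: "R \<ge> 0" using M_nonneg \<rho>_pos by (simp add: R_def)
  have "continuous_on UNIV Q" unfolding Q_def by (intro continuous_intros F_continuous)
  then have "continuous_on (cball x R) Q" by (rule continuous_on_subset) simp
  then obtain p where p: "p \<in> cball x R" "\<And>z. z \<in> cball x R \<Longrightarrow> Q p \<le> Q z"
    using continuous_attains_inf[of "cball x R" Q] R by auto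
  have "Q p \<le> Q z" for z
  proof (cases "z \<in> cball x R")
    case False
    define n where "n = norm (z - x)"
    have n: "n > R" using False by (simp add: n_def dist_norm norm_minus_commute)
    have "Q p \<le> Q x" using p R by simp
    also have "\<dots> = F x" by (simp add: Q_def)
    also have "\<dots> \<le> F x + n * (\<rho> / 2 * n - M)"
    proof -
      have "\<rho> / 2 * n - M \<ge> 0" using n \<rho>_pos by (simp add: R_def field_simps)
      then show ?thesis using n R by simp
    qed
    also have "\<dots> = F x - M * n - \<delta> / 2 * n\<^sup>2 + 1 / (2 * \<gamma>) * n\<^sup>2"
      unfolding \<rho>_def power2_eq_square by (simp add: algebra_simps diff_divide_distrib)
    also have "\<dots> \<le> Q z" using F_lower[of x z] by (simp add: Q_def n_def)
    finally show ?thesis .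
  qed (use p in auto)
  then show ?thesis unfolding Q_def by blast
qed

lemma pr_min: "F (pr x) + 1 / (2 * \<gamma>) * (norm (pr x - x))\<^sup>2 \<le> F z + 1 / (2 * \<gamma>) * (norm (z - x))\<^sup>2"
proof -
  define Q where "Q z = F z + 1 / (2 * \<gamma>) * (norm (z - x))\<^sup>2" for z
  obtain p where "\<And>z. Q p \<le> Q z" using proximal_objective_attains unfolding Q_def by blast
  then have "is_arg_min Q (\<lambda>_. True) p" by (simp add: is_arg_min_linorder)
  then have "is_arg_min Q (\<lambda>_. True) (pr x)" unfolding prox_def arg_min_def Q_def by (rule someI)
  then show ?thesis by (simp add: is_arg_min_linorder Q_def)
qed

lemma env_eq: "env x = F (pr x) + 1 / (2 * \<gamma>) * (norm (pr x - x))\<^sup>2"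
  unfolding moreau_env_def by (rule cInf_eq_minimum) (use pr_min in auto)

lemma env_le: "env x \<le> F z + 1 / (2 * \<gamma>) * (norm (z - x))\<^sup>2"
  using pr_min env_eq by simp

text \<open>Minimality of \<open>pr x\<close> concerns the maximum over \<open>y\<close>; here it is transferred to the single function at the
maximizer \<open>ys (pr x)\<close>.  With \<open>p = pr x\<close>, \<open>p\<^sub>s\<close> on the segment from \<open>p\<close> to \<open>z\<close> and \<open>y\<^sub>s = ys p\<^sub>s\<close>,
minimality of \<open>p\<close> and convexity give
\<open>\<psi> p (ys p) \<le> \<psi> p\<^sub>s y\<^sub>s \<le> (1 - s) * \<psi> p (ys p) + s * \<psi> z y\<^sub>s\<close>, hence \<open>\<psi> p (ys p) \<le> \<psi> z y\<^sub>s\<close>.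
Then \<open>s\<close> tends to \<open>0\<close> and \<open>y\<^sub>s\<close> to \<open>ys p\<close>.\<close>

lemma saddle_point:
  "\<phi> (pr x) (ys (pr x)) + 1 / (2 * \<gamma>) * (norm (pr x - x))\<^sup>2
    \<le> \<phi> z (ys (pr x)) + 1 / (2 * \<gamma>) * (norm (z - x))\<^sup>2"
proof -
  define \<psi> where "\<psi> u y = \<phi> u y + 1 / (2 * \<gamma>) * (norm (u - x))\<^sup>2" for u y
  define p where "p = pr x"
  define ps where "ps s = p + s *\<^sub>R (z - p)" for s :: real
  define c where "c = 1 / (2 * \<gamma>)"
  define h where "h = \<delta> / 2"
  have ch: "c - h \<ge> 0" using \<rho>_pos by (simp add: c_def h_def \<rho>_def)
  have conv: "\<psi> (ps s) y \<le> (1 - s) * \<psi> p y + s * \<psi> z y" if "y \<in> Y" "0 < s" "s < 1" for s y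
  proof -
    have "\<psi> (ps s) y \<le> (1 - s) * \<psi> p y + s * \<psi> z y - (c - h) * (s * (1 - s) * (norm (z - p))\<^sup>2)"
      using weakly_convex_segment[OF wc[OF that(1)], of s p z] that
      unfolding \<psi>_def ps_def norm_sq_segment c_def[symmetric] h_def[symmetric]
      by (simp add: algebra_simps)
    moreover have "(c - h) * (s * (1 - s) * (norm (z - p))\<^sup>2) \<ge> 0" using ch that by simp
    ultimately show ?thesis by linarith
  qed
  have ev: "\<forall>\<^sub>F s in at_right 0. \<psi> p (ys p) \<le> \<psi> z (ys (ps s))"
    using eventually_at_right_unit
  proof eventually_elim
    case (elim s)
    have "\<psi> p (ys p) \<le> \<psi> (ps s) (ys (ps s))"
      using pr_min[of x "ps s"] unfolding F_eq \<psi>_def p_def .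
    also have "\<dots> \<le> (1 - s) * \<psi> p (ys (ps s)) + s * \<psi> z (ys (ps s))"
      using conv[OF ys_in] elim by blast
    also have "\<dots> \<le> (1 - s) * \<psi> p (ys p) + s * \<psi> z (ys (ps s))"
      using ys_max[OF ys_in, of p "ps s"] elim by (intro add_right_mono mult_left_mono) (auto simp: \<psi>_def)
    finally have "s * \<psi> p (ys p) \<le> s * \<psi> z (ys (ps s))" by (simp add: algebra_simps)
    then show ?case using elim by simp
  qed
  have "(ps \<longlongrightarrow> p + 0 *\<^sub>R (z - p)) (at_right 0)" unfolding ps_def by (intro tendsto_intros)
  then have "(ps \<longlongrightarrow> p) (at_right 0)" by simp
  then have "((\<lambda>s. ys (ps s)) \<longlongrightarrow> ys p) (at_right 0)"
    using continuous_on_tendsto_compose[OF ys_continuous] by simp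
  then have "((\<lambda>s. \<phi> z (ys (ps s))) \<longlongrightarrow> \<phi> z (ys p)) (at_right 0)"
    by (rule continuous_on_tendsto_compose[OF \<phi>_continuous]) (use ys_in in auto)
  then have "((\<lambda>s. \<psi> z (ys (ps s))) \<longlongrightarrow> \<psi> z (ys p)) (at_right 0)"
    unfolding \<psi>_def by (intro tendsto_intros)
  then have "\<psi> p (ys p) \<le> \<psi> z (ys p)"
    by (rule tendsto_lowerbound[OF _ ev]) simp
  then show ?thesis by (simp add: \<psi>_def p_def)
qed

lemma saddle_growth:
  "\<phi> (pr x) (ys (pr x)) + 1 / (2 * \<gamma>) * (norm (pr x - x))\<^sup>2 + \<rho> / 2 * (norm (z - pr x))\<^sup>2
    \<le> \<phi> z (ys (pr x)) + 1 / (2 * \<gamma>) * (norm (z - x))\<^sup>2"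
  using proximal_growth[OF wc[OF ys_in] saddle_point] unfolding \<rho>_def .

lemma pr_growth:
  "F (pr x) + 1 / (2 * \<gamma>) * (norm (pr x - x))\<^sup>2 + \<rho> / 2 * (norm (z - pr x))\<^sup>2
    \<le> F z + 1 / (2 * \<gamma>) * (norm (z - x))\<^sup>2"
  using saddle_growth[of x z] \<phi>_le_F[OF ys_in, of z "pr x"] F_eq[of "pr x"] by simp

text \<open>Sum of the growth inequalities at the two proximal points: the values of \<open>F\<close> cancel and the
quadratic terms combine to the inner product of \<open>pr x - pr z\<close> with \<open>x - z\<close>.\<close>

lemma pr_lipschitz: "norm (pr x - pr z) \<le> 1 / (\<gamma> * \<rho>) * norm (x - z)"
proof -
  define c where "c = 1 / (2 * \<gamma>)"
  have c: "2 * c > 0" using \<gamma>_pos by (simp add: c_def)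
  define n where "n = norm (pr x - pr z)"
  have "\<rho> * n\<^sup>2 \<le> c * ((norm (pr z - x))\<^sup>2 - (norm (pr x - x))\<^sup>2 + (norm (pr x - z))\<^sup>2 - (norm (pr z - z))\<^sup>2)"
    using pr_growth[of x "pr z"] pr_growth[of z "pr x"] unfolding c_def[symmetric]
    by (simp add: n_def norm_minus_commute algebra_simps)
  also have "\<dots> = 2 * c * ((pr x - pr z) \<bullet> (x - z))"
    unfolding power2_norm_eq_inner
    by (simp add: inner_diff_left inner_diff_right inner_commute algebra_simps)
  also have "\<dots> \<le> 2 * c * (n * norm (x - z))"
    unfolding n_def using c by (intro mult_left_mono norm_cauchy_schwarz) auto
  finally have *: "n * (\<rho> * n) \<le> n * (2 * c * norm (x - z))" by (simp add: power2_eq_square algebra_simps)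
  have "\<rho> * n \<le> 2 * c * norm (x - z)"
  proof (cases "n = 0")
    case False
    then have "n > 0" by (simp add: n_def)
    then show ?thesis using * by simp
  qed (use c in auto)
  then have "\<rho> * n * \<gamma> \<le> norm (x - z)" using \<gamma>_pos by (simp add: c_def field_simps)
  then show ?thesis using \<rho>_pos \<gamma>_pos by (simp add: n_def field_simps)
qed

lemma pr_continuous: "continuous_on UNIV pr"
proof (rule lipschitz_on_continuous_on)
  show "(1 / (\<gamma> * \<rho>))-lipschitz_on UNIV pr"
    using pr_lipschitz \<gamma>_pos \<rho>_pos by (auto intro!: lipschitz_onI simp: dist_norm)
qed

lemma env_grad_continuous: "continuous_on UNIV env_grad"
  unfolding env_grad_def by (intro continuous_intros pr_continuous)

lemma norm_sq_shift:
  "1 / (2 * \<gamma>) * (norm (pr x - z))\<^sup>2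
   = 1 / (2 * \<gamma>) * (norm (pr x - x))\<^sup>2 + env_grad x \<bullet> (z - x) + 1 / (2 * \<gamma>) * (norm (z - x))\<^sup>2"
proof -
  have "(norm (pr x - z))\<^sup>2 = (norm (pr x - x))\<^sup>2 + 2 * ((x - pr x) \<bullet> (z - x)) + (norm (z - x))\<^sup>2"
    unfolding power2_norm_eq_inner
    by (simp add: inner_diff_left inner_diff_right inner_commute algebra_simps)
  moreover have "(x - pr x) \<bullet> (z - x) = \<gamma> * (env_grad x \<bullet> (z - x))"
    using \<gamma>_pos unfolding env_grad_def by simp
  ultimately show ?thesis using \<gamma>_pos by (simp add: field_simps)
qed

text \<open>The upper bound has curvature \<open>1 / \<gamma>\<close> for every \<open>\<delta>\<close>, because it only tests the definition of the
envelope at \<open>z\<close> with the competitor \<open>pr x\<close>.  A matching lower bound would need a constant that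
degenerates as \<open>\<gamma> * \<delta>\<close> approaches \<open>1\<close>.\<close>

lemma env_upper: "env z \<le> env x + env_grad x \<bullet> (z - x) + 1 / (2 * \<gamma>) * (norm (z - x))\<^sup>2"
  using env_le[of z "pr x"] norm_sq_shift[of x z] env_eq[of x] by linarith

text \<open>The upper bound at \<open>x\<close> and the same bound at \<open>z\<close>, with the roles exchanged, enclose the remainder;
continuity of \<open>env_grad\<close> makes the enclosure of smaller order than \<open>norm (z - x)\<close>.\<close>

lemma env_gderiv: "GDERIV env x :> env_grad x"
proof -
  define b where "b z = norm (env_grad z - env_grad x) + 1 / (2 * \<gamma>) * norm (z - x)" for z
  have bound: "\<bar>env z - env x - env_grad x \<bullet> (z - x)\<bar> \<le> b z * norm (z - x)" for z
  proof -
    have "env z - env x - env_grad x \<bullet> (z - x) \<le> 1 / (2 * \<gamma>) * (norm (z - x))\<^sup>2"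
      using env_upper[of z x] by linarith
    moreover have "1 / (2 * \<gamma>) * (norm (z - x))\<^sup>2 \<le> b z * norm (z - x)"
      by (simp add: b_def power2_eq_square distrib_right)
    moreover have "env x \<le> env z - env_grad z \<bullet> (z - x) + 1 / (2 * \<gamma>) * (norm (z - x))\<^sup>2"
      using env_upper[of x z] by (simp add: norm_minus_commute inner_diff_right)
    moreover have "- (norm (env_grad z - env_grad x) * norm (z - x)) \<le> (env_grad z - env_grad x) \<bullet> (z - x)"
      using Cauchy_Schwarz_ineq2[of "env_grad z - env_grad x" "z - x"] by linarith
    moreover have "0 \<le> norm (env_grad z - env_grad x) * norm (z - x)" by simp
    ultimately show ?thesis
      unfolding b_def power2_eq_square distrib_right inner_diff_left abs_le_iff by linarith
  qed
  have "(env_grad \<longlongrightarrow> env_grad x) (at x)"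
    using env_grad_continuous by (simp add: continuous_on_def)
  then have "(b \<longlongrightarrow> norm (env_grad x - env_grad x) + 1 / (2 * \<gamma>) * norm (x - x)) (at x)"
    unfolding b_def by (intro tendsto_intros)
  then have b: "(b \<longlongrightarrow> 0) (at x)" by simp
  have "((\<lambda>z. norm (env z - env x - (z - x) \<bullet> env_grad x) / norm (z - x)) \<longlongrightarrow> 0) (at x)"
  proof (rule Lim_null_comparison[OF _ b])
    show "\<forall>\<^sub>F z in at x. norm (norm (env z - env x - (z - x) \<bullet> env_grad x) / norm (z - x)) \<le> b z"
      unfolding eventually_at_filter using bound
      by (auto simp: inner_commute divide_le_eq)
  qed
  then show ?thesis
    unfolding gderiv_def has_derivative_iff_norm by (auto intro: bounded_linear_inner_left)
qed

lemma gradient_env: "gradient env x = env_grad x"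
  unfolding gradient_def
proof (rule the_equality[of _ "env_grad x"])
  show "GDERIV env x :> env_grad x" by (rule env_gderiv)
  fix d assume "GDERIV env x :> d"
  then have "(\<lambda>h. h \<bullet> d) = (\<lambda>h. h \<bullet> env_grad x)"
    using env_gderiv unfolding gderiv_def by (rule has_derivative_unique)
  then have "h \<bullet> d = h \<bullet> env_grad x" for h by metis
  then show "d = env_grad x" using vector_eq_ldot by blast
qed

lemma pr_env_grad: "pr x = x - \<gamma> *\<^sub>R env_grad x"
  using \<gamma>_pos by (simp add: env_grad_def)

lemma env_grad_in_subdifferential: "env_grad x \<in> subdifferential F (pr x)"
  unfolding subdifferential_def
proof (intro CollectI bexI[of _ "\<lambda>z. - (1 / (2 * \<gamma>) * (norm (z - pr x))\<^sup>2)"] always_eventually allI)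
  fix z
  have "1 / (2 * \<gamma>) * (norm (z - x))\<^sup>2 = 1 / (2 * \<gamma>) * (norm (pr x - x))\<^sup>2
      - env_grad x \<bullet> (z - pr x) + 1 / (2 * \<gamma>) * (norm (z - pr x))\<^sup>2"
  proof -
    have "(norm (z - x))\<^sup>2 = (norm (pr x - x))\<^sup>2 - 2 * ((x - pr x) \<bullet> (z - pr x)) + (norm (z - pr x))\<^sup>2"
      unfolding power2_norm_eq_inner
      by (simp add: inner_diff_left inner_diff_right inner_commute algebra_simps)
    moreover have "(x - pr x) \<bullet> (z - pr x) = \<gamma> * (env_grad x \<bullet> (z - pr x))"
      using \<gamma>_pos unfolding env_grad_def by simp
    ultimately show ?thesis using \<gamma>_pos by (simp add: field_simps)
  qed
  then show "F (pr x) + env_grad x \<bullet> (z - pr x) + - (1 / (2 * \<gamma>) * (norm (z - pr x))\<^sup>2) \<le> F z"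
    using pr_min[of x z] by linarith
next
  have "((\<lambda>z. (- (1 / (2 * \<gamma>) * (norm (z - pr x))\<^sup>2)) / norm (z - pr x)) \<longlongrightarrow> 0) (at (pr x))"
  proof (rule Lim_null_comparison)
    show "\<forall>\<^sub>F z in at (pr x). norm ((- (1 / (2 * \<gamma>) * (norm (z - pr x))\<^sup>2)) / norm (z - pr x))
        \<le> 1 / (2 * \<gamma>) * norm (z - pr x)"
      using \<gamma>_pos by (auto simp: eventually_at_filter power2_eq_square)
    have "((\<lambda>z. 1 / (2 * \<gamma>) * norm (z - pr x)) \<longlongrightarrow> 1 / (2 * \<gamma>) * norm (pr x - pr x)) (at (pr x))"
      by (intro tendsto_intros)
    then show "((\<lambda>z. 1 / (2 * \<gamma>) * norm (z - pr x)) \<longlongrightarrow> 0) (at (pr x))" by simp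
  qed
  then show "(\<lambda>z. - (1 / (2 * \<gamma>) * (norm (z - pr x))\<^sup>2)) \<in> o[at (pr x)](\<lambda>z. norm (z - pr x))"
    by (intro smalloI_tendsto) (auto simp: eventually_at_filter)
qed

text \<open>Optimality of \<open>pr x\<close> for the single function \<open>\<lambda>u. \<phi> u (ys (pr x))\<close> makes that function increase at
rate at least \<open>norm w\<close> when leaving \<open>pr x\<close> in the direction \<open>w = env_grad x\<close>, while its subgradients
of norm at most \<open>M\<close> allow a rate of at most \<open>M\<close>.\<close>

lemma env_grad_bound: "norm (env_grad x) \<le> M"
proof -
  define w where "w = env_grad x"
  define p where "p = pr x"
  define f where "f u = \<phi> u (ys p)" for u
  define c where "c = 1 / (2 * \<gamma>)"
  have "norm w * norm w \<le> M * norm w"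
  proof (rule le_of_eventually_le_linear[where k = "(\<delta> / 2 + c) * (norm w)\<^sup>2"])
    fix e :: real assume e: "e > 0"
    from eventually_at_right_unit
    show "\<forall>\<^sub>F s in at_right 0. norm w * norm w \<le> M * norm w + e + (\<delta> / 2 + c) * (norm w)\<^sup>2 * s"
    proof eventually_elim
      case (elim s)
      define z where "z = p + s *\<^sub>R w"
      have "f p + c * (norm (p - x))\<^sup>2 \<le> f z + c * (norm (z - x))\<^sup>2"
        using saddle_point[of x z] by (simp add: f_def p_def c_def)
      moreover have "(norm (z - x))\<^sup>2 = (norm (p - x))\<^sup>2 - 2 * s * \<gamma> * (norm w * norm w) + s\<^sup>2 * (norm w)\<^sup>2"
      proof -
        have "x - p = \<gamma> *\<^sub>R w" using \<gamma>_pos by (simp add: w_def env_grad_def p_def)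
        then have 1: "z - x = (s - \<gamma>) *\<^sub>R w" and 2: "p - x = (- \<gamma>) *\<^sub>R w"
          by (auto simp: z_def algebra_simps)
        have 3: "(norm (k *\<^sub>R w))\<^sup>2 = k\<^sup>2 * (norm w)\<^sup>2" for k
          by (simp add: power_mult_distrib)
        show ?thesis unfolding 1 2 3 by (simp add: power2_eq_square algebra_simps)
      qed
      ultimately have "f p + c * (2 * s * \<gamma> * (norm w * norm w)) \<le> f z + c * (s\<^sup>2 * (norm w)\<^sup>2)"
        by (simp add: algebra_simps)
      moreover have "c * (2 * s * \<gamma> * (norm w * norm w)) = s * (norm w * norm w)"
        using \<gamma>_pos by (simp add: c_def)
      moreover
      obtain v where v: "v \<in> subdifferential f z" "norm v \<le> M"
        using subgrad_ex[OF ys_in] unfolding f_def by blast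
      have "weakly_convex \<delta> f" unfolding f_def using wc[OF ys_in] .
      from weakly_convex_subgradient_ineq[OF this v(1), of p]
      have "f z - s * (v \<bullet> w) - \<delta> / 2 * (s\<^sup>2 * (norm w)\<^sup>2) \<le> f p"
        using elim by (simp add: z_def power_mult_distrib)
      moreover have "s * (v \<bullet> w) \<le> s * (M * norm w)"
        using norm_cauchy_schwarz[of v w] mult_right_mono[OF v(2) norm_ge_zero[of w]] elim
        by (intro mult_left_mono) linarith+
      ultimately have "s * (norm w * norm w) \<le> s * (M * norm w) + c * (s\<^sup>2 * (norm w)\<^sup>2) + \<delta> / 2 * (s\<^sup>2 * (norm w)\<^sup>2)"
        by linarith
      also have "\<dots> = s * (M * norm w + (\<delta> / 2 + c) * (norm w)\<^sup>2 * s)"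
        by (simp add: algebra_simps power2_eq_square)
      finally show ?case using elim e by simp
    qed
  qed
  then show ?thesis using M_nonneg unfolding w_def by (cases "env_grad x = 0") auto
qed

text \<open>The saddle operator of the regularized problem, compared with its zero at the saddle point.  Strong
convexity in \<open>u\<close> and strong concavity in \<open>y\<close> each contribute twice, once through the first-order
inequality at \<open>(u, y)\<close> and once through the growth at the saddle point, which explains the factors
\<open>\<rho>\<close> and \<open>\<mu>\<close> instead of their halves.\<close>

lemma saddle_strong_monotonicity:
  assumes y: "y \<in> Y" and g: "g \<in> subdifferential (\<lambda>x. \<phi> x y) u"
  shows "(u - pr x) \<bullet> (g + (1 / \<gamma>) *\<^sub>R (u - x)) - (y - ys (pr x)) \<bullet> grad_y u y
    \<ge> \<rho> * (norm (u - pr x))\<^sup>2 + \<mu> * (norm (y - ys (pr x)))\<^sup>2"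
proof -
  define p q where "p = pr x" and "q = ys p"
  have q: "q \<in> Y" by (simp add: q_def ys_in)
  have 1: "\<phi> p y \<ge> \<phi> u y - (u - p) \<bullet> g - \<delta> / 2 * (norm (u - p))\<^sup>2"
    using weakly_convex_subgradient_ineq[OF wc[OF y] g, of p]
    by (simp add: inner_diff_right inner_commute norm_minus_commute algebra_simps)
  have "(norm (p - x))\<^sup>2 = (norm (u - x))\<^sup>2 - 2 * ((u - p) \<bullet> (u - x)) + (norm (u - p))\<^sup>2"
    unfolding power2_norm_eq_inner
    by (simp add: inner_diff_left inner_diff_right inner_commute algebra_simps)
  then have 2: "1 / (2 * \<gamma>) * (norm (p - x))\<^sup>2 = 1 / (2 * \<gamma>) * (norm (u - x))\<^sup>2
     - (u - p) \<bullet> ((1 / \<gamma>) *\<^sub>R (u - x)) + 1 / (2 * \<gamma>) * (norm (u - p))\<^sup>2"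
    using \<gamma>_pos unfolding inner_scaleR_right by (simp add: field_simps)
  have 3: "\<phi> u q \<le> \<phi> u y - (y - q) \<bullet> grad_y u y - \<mu> / 2 * (norm (y - q))\<^sup>2"
    using \<phi>_gradient_ineq[OF y q, of u]
    by (simp add: inner_diff_right inner_commute norm_minus_commute algebra_simps)
  have 4: "\<phi> p q + 1 / (2 * \<gamma>) * (norm (p - x))\<^sup>2 + \<rho> / 2 * (norm (u - p))\<^sup>2
     \<le> \<phi> u q + 1 / (2 * \<gamma>) * (norm (u - x))\<^sup>2"
    using saddle_growth[of x u] by (simp add: p_def q_def)
  have 5: "\<phi> p y \<le> \<phi> p q - \<mu> / 2 * (norm (y - q))\<^sup>2" using ys_growth[OF y] by (simp add: q_def)
  have 6: "\<rho> / 2 * (norm (u - p))\<^sup>2 = 1 / (2 * \<gamma>) * (norm (u - p))\<^sup>2 - \<delta> / 2 * (norm (u - p))\<^sup>2"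
    using \<gamma>_pos unfolding \<rho>_def by (simp add: field_simps)
  show ?thesis
    unfolding p_def[symmetric] q_def[symmetric] inner_add_right
    using 1 2 3 4 5 6 by (simp add: field_simps)
qed

end

section \<open>Square integrability, conditional expectation and random indices\<close>

definition square_integrable :: "'w measure \<Rightarrow> ('w \<Rightarrow> 'a::euclidean_space) \<Rightarrow> bool" where
  "square_integrable P f \<longleftrightarrow> f \<in> borel_measurable P \<and> integrable P (\<lambda>\<omega>. (norm (f \<omega>))\<^sup>2)"

lemma norm_sq_integrable: "square_integrable P f \<Longrightarrow> integrable P (\<lambda>\<omega>. (norm (f \<omega>))\<^sup>2)"
  by (simp add: square_integrable_def)

lemma norm_add_sq_le: "(norm (a + b))\<^sup>2 \<le> 2 * (norm a)\<^sup>2 + 2 * (norm (b::'a::real_inner))\<^sup>2"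
  using zero_le_power2[of "norm (a - b)"] unfolding power2_norm_eq_inner
  by (simp add: inner_diff_left inner_diff_right inner_add_left inner_add_right inner_commute)

lemma square_integrable_add:
  assumes "square_integrable P f" "square_integrable P g"
  shows "square_integrable P (\<lambda>\<omega>. f \<omega> + g \<omega>)"
proof -
  have m[measurable]: "f \<in> borel_measurable P" "g \<in> borel_measurable P"
    using assms by (auto simp: square_integrable_def)
  have "integrable P (\<lambda>\<omega>. (norm (f \<omega> + g \<omega>))\<^sup>2)"
  proof (rule Bochner_Integration.integrable_bound)
    show "integrable P (\<lambda>\<omega>. 2 * (norm (f \<omega>))\<^sup>2 + 2 * (norm (g \<omega>))\<^sup>2)"
      using assms by (auto simp: square_integrable_def)
    show "AE \<omega> in P. norm ((norm (f \<omega> + g \<omega>))\<^sup>2) \<le> norm (2 * (norm (f \<omega>))\<^sup>2 + 2 * (norm (g \<omega>))\<^sup>2)"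
      using norm_add_sq_le by auto
  qed measurable
  then show ?thesis by (simp add: square_integrable_def)
qed

lemma square_integrable_scaleR:
  "square_integrable P f \<Longrightarrow> square_integrable P (\<lambda>\<omega>. c *\<^sub>R f \<omega>)"
  unfolding square_integrable_def by (auto simp: power_mult_distrib)

lemma square_integrable_diff:
  assumes "square_integrable P f" "square_integrable P g"
  shows "square_integrable P (\<lambda>\<omega>. f \<omega> - g \<omega>)"
  using square_integrable_add[OF assms(1) square_integrable_scaleR[OF assms(2), of "-1"]] by simp

lemma square_integrable_inner:
  assumes "square_integrable P f" "square_integrable P g"
  shows "integrable P (\<lambda>\<omega>. f \<omega> \<bullet> g \<omega>)"
proof (rule Bochner_Integration.integrable_bound)
  show "integrable P (\<lambda>\<omega>. (norm (f \<omega>))\<^sup>2 + (norm (g \<omega>))\<^sup>2)"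
    using assms by (auto simp: square_integrable_def)
  have "\<bar>f \<omega> \<bullet> g \<omega>\<bar> \<le> (norm (f \<omega>))\<^sup>2 + (norm (g \<omega>))\<^sup>2" for \<omega>
    using Cauchy_Schwarz_ineq2[of "f \<omega>" "g \<omega>"] sum_squares_bound[of "norm (f \<omega>)" "norm (g \<omega>)"]
      mult_nonneg_nonneg[OF norm_ge_zero norm_ge_zero, of "f \<omega>" "g \<omega>"] by linarith
  then show "AE \<omega> in P. norm (f \<omega> \<bullet> g \<omega>) \<le> norm ((norm (f \<omega>))\<^sup>2 + (norm (g \<omega>))\<^sup>2)" by simp
qed (use assms in \<open>auto simp: square_integrable_def\<close>)

lemma (in finite_measure) square_integrable_bounded:
  assumes "f \<in> borel_measurable M" "\<And>\<omega>. \<omega> \<in> space M \<Longrightarrow> norm (f \<omega>) \<le> B"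
  shows "square_integrable M f"
proof -
  have "integrable M (\<lambda>\<omega>. (norm (f \<omega>))\<^sup>2)"
  proof (rule integrable_const_bound)
    show "AE \<omega> in M. norm ((norm (f \<omega>))\<^sup>2) \<le> B\<^sup>2"
      using assms(2) by (intro AE_I2) (auto intro: power_mono)
  qed (use assms(1) in measurable)
  then show ?thesis using assms by (simp add: square_integrable_def)
qed

lemma square_integrable_cong:
  assumes "\<And>\<omega>. \<omega> \<in> space P \<Longrightarrow> f \<omega> = g \<omega>"
  shows "square_integrable P f = square_integrable P g"
proof -
  have "f \<in> borel_measurable P \<longleftrightarrow> g \<in> borel_measurable P"
    by (rule measurable_cong) (use assms in auto)
  moreover have "integrable P (\<lambda>\<omega>. (norm (f \<omega>))\<^sup>2) = integrable P (\<lambda>\<omega>. (norm (g \<omega>))\<^sup>2)"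
    by (rule Bochner_Integration.integrable_cong) (use assms in auto)
  ultimately show ?thesis by (simp add: square_integrable_def)
qed

text \<open>Conditional unbiasedness in the form in which it is used: in the mean, an estimator can be replaced
by its conditional expectation when it is paired with something known at the time of the draw.\<close>

lemma (in finite_measure_subalgebra) vec_cond_exp_inner:
  assumes a: "a \<in> borel_measurable F" "square_integrable M a" and g: "square_integrable M g"
  shows "integrable M (\<lambda>\<omega>. a \<omega> \<bullet> vec_cond_exp M F g \<omega>)"
    and "(\<integral>\<omega>. a \<omega> \<bullet> vec_cond_exp M F g \<omega> \<partial>M) = (\<integral>\<omega>. a \<omega> \<bullet> g \<omega> \<partial>M)"
proof -
  have [measurable]: "g \<in> borel_measurable M" "a \<in> borel_measurable F" "a \<in> borel_measurable M"
    using a g by (auto simp: square_integrable_def)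
  have int: "integrable M (\<lambda>\<omega>. (a \<omega> \<bullet> b) * (g \<omega> \<bullet> b))" if b: "b \<in> Basis" for b
  proof (rule Bochner_Integration.integrable_bound)
    show "integrable M (\<lambda>\<omega>. (norm (a \<omega>))\<^sup>2 + (norm (g \<omega>))\<^sup>2)"
      using a g by (auto simp: square_integrable_def)
    have "\<bar>(a \<omega> \<bullet> b) * (g \<omega> \<bullet> b)\<bar> \<le> (norm (a \<omega>))\<^sup>2 + (norm (g \<omega>))\<^sup>2" for \<omega>
    proof -
      have "\<bar>(a \<omega> \<bullet> b) * (g \<omega> \<bullet> b)\<bar> \<le> norm (a \<omega>) * norm (g \<omega>)"
        unfolding abs_mult using b by (intro mult_mono) (auto simp: Basis_le_norm)
      then show ?thesis
        using sum_squares_bound[of "norm (a \<omega>)" "norm (g \<omega>)"]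
          mult_nonneg_nonneg[OF norm_ge_zero norm_ge_zero, of "a \<omega>" "g \<omega>"] by linarith
    qed
    then show "AE \<omega> in M. norm ((a \<omega> \<bullet> b) * (g \<omega> \<bullet> b)) \<le> norm ((norm (a \<omega>))\<^sup>2 + (norm (g \<omega>))\<^sup>2)"
      by simp
  qed measurable
  have eq: "a \<omega> \<bullet> vec_cond_exp M F g \<omega> = (\<Sum>b\<in>Basis. (a \<omega> \<bullet> b) * real_cond_exp M F (\<lambda>\<omega>. g \<omega> \<bullet> b) \<omega>)" for \<omega>
    unfolding vec_cond_exp_def by (simp add: inner_sum_right mult.commute)
  have 1: "integrable M (\<lambda>\<omega>. (a \<omega> \<bullet> b) * real_cond_exp M F (\<lambda>\<omega>. g \<omega> \<bullet> b) \<omega>)"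
    and 2: "(\<integral>\<omega>. (a \<omega> \<bullet> b) * real_cond_exp M F (\<lambda>\<omega>. g \<omega> \<bullet> b) \<omega> \<partial>M) = (\<integral>\<omega>. (a \<omega> \<bullet> b) * (g \<omega> \<bullet> b) \<partial>M)"
    if "b \<in> Basis" for b
    using real_cond_exp_intg[OF int[OF that]] by auto
  show "integrable M (\<lambda>\<omega>. a \<omega> \<bullet> vec_cond_exp M F g \<omega>)"
    unfolding eq using 1 by auto
  have "(\<integral>\<omega>. a \<omega> \<bullet> vec_cond_exp M F g \<omega> \<partial>M) = (\<Sum>b\<in>Basis. \<integral>\<omega>. (a \<omega> \<bullet> b) * (g \<omega> \<bullet> b) \<partial>M)"
    unfolding eq using 1 2 by (simp add: Bochner_Integration.integral_sum)
  also have "\<dots> = (\<integral>\<omega>. (\<Sum>b\<in>Basis. (a \<omega> \<bullet> b) * (g \<omega> \<bullet> b)) \<partial>M)"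
    using int by (simp add: Bochner_Integration.integral_sum)
  finally show "(\<integral>\<omega>. a \<omega> \<bullet> vec_cond_exp M F g \<omega> \<partial>M) = (\<integral>\<omega>. a \<omega> \<bullet> g \<omega> \<partial>M)"
    by (simp add: euclidean_inner[symmetric])
qed

lemma
  assumes [measurable]: "g \<in> borel_measurable P"
    and le: "(\<integral>\<^sup>+\<omega>. ennreal ((norm (g \<omega>))\<^sup>2) \<partial>P) \<le> ennreal (M\<^sup>2)"
  shows square_integrable_of_second_moment: "square_integrable P g"
    and second_moment_le: "(\<integral>\<omega>. (norm (g \<omega>))\<^sup>2 \<partial>P) \<le> M\<^sup>2"
proof -
  have int: "integrable P (\<lambda>\<omega>. (norm (g \<omega>))\<^sup>2)"
    by (rule integrableI_bounded) (use le in \<open>auto simp: order_le_less_trans\<close>)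
  then show "square_integrable P g" by (simp add: square_integrable_def)
  show "(\<integral>\<omega>. (norm (g \<omega>))\<^sup>2 \<partial>P) \<le> M\<^sup>2"
    using le nn_integral_eq_integral[OF int] by simp
qed

lemma (in prob_space)
  assumes f: "square_integrable M f" and b: "b > 0"
  shows integrable_norm_of_square: "integrable M (\<lambda>\<omega>. norm (f \<omega>))"
    and first_moment_le: "(\<integral>\<omega>. norm (f \<omega>) \<partial>M) \<le> ((\<integral>\<omega>. (norm (f \<omega>))\<^sup>2 \<partial>M) / b + b) / 2"
proof -
  have [measurable]: "f \<in> borel_measurable M" using f by (simp add: square_integrable_def)
  note sq = norm_sq_integrable[OF f]
  then show int: "integrable M (\<lambda>\<omega>. norm (f \<omega>))"
    by (rule square_integrable_imp_integrable[rotated]) measurable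
  have "(\<integral>\<omega>. norm (f \<omega>) \<partial>M) \<le> (\<integral>\<omega>. ((norm (f \<omega>))\<^sup>2 / b + b) / 2 \<partial>M)"
  proof (rule integral_mono)
    fix \<omega>
    show "norm (f \<omega>) \<le> ((norm (f \<omega>))\<^sup>2 / b + b) / 2"
      using b sum_squares_bound[of "norm (f \<omega>)" b] by (simp add: field_simps power2_eq_square)
  qed (use sq int in auto)
  then show "(\<integral>\<omega>. norm (f \<omega>) \<partial>M) \<le> ((\<integral>\<omega>. (norm (f \<omega>))\<^sup>2 \<partial>M) / b + b) / 2"
    using sq by (simp add: prob_space)
qed

lemma cond_second_moment:
  assumes "prob_space P" "subalgebra P hist" and g[measurable]: "g \<in> borel_measurable P"
    and bound: "AE \<omega> in P. nn_cond_exp P hist (\<lambda>\<omega>. ennreal ((norm (g \<omega>))\<^sup>2)) \<omega> \<le> ennreal (M\<^sup>2)"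
  shows "square_integrable P g" and "(\<integral>\<omega>. (norm (g \<omega>))\<^sup>2 \<partial>P) \<le> M\<^sup>2"
proof -
  interpret P: prob_space P by fact
  interpret hist: finite_measure_subalgebra P hist by unfold_locales fact
  have "(\<integral>\<^sup>+\<omega>. ennreal ((norm (g \<omega>))\<^sup>2) \<partial>P) = (\<integral>\<^sup>+\<omega>. nn_cond_exp P hist (\<lambda>\<omega>. ennreal ((norm (g \<omega>))\<^sup>2)) \<omega> \<partial>P)"
    using hist.nn_cond_exp_intg[of "\<lambda>_. 1" "\<lambda>\<omega>. ennreal ((norm (g \<omega>))\<^sup>2)"] by simp
  also have "\<dots> \<le> (\<integral>\<^sup>+\<omega>. ennreal (M\<^sup>2) \<partial>P)" using bound by (rule nn_integral_mono_AE)
  also have "\<dots> = ennreal (M\<^sup>2)" by (simp add: P.emeasure_space_1)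
  finally have le: "(\<integral>\<^sup>+\<omega>. ennreal ((norm (g \<omega>))\<^sup>2) \<partial>P) \<le> ennreal (M\<^sup>2)" .
  show "square_integrable P g" "(\<integral>\<omega>. (norm (g \<omega>))\<^sup>2 \<partial>P) \<le> M\<^sup>2"
    using square_integrable_of_second_moment[OF g le] second_moment_le[OF g le] by auto
qed

lemma
  fixes Z :: "nat \<Rightarrow> 'w \<Rightarrow> 'z::topological_space"
  assumes Z: "\<And>s. s \<le> t \<Longrightarrow> Z s \<in> borel_measurable P"
  shows subalgebra_history: "subalgebra P (history P Z t)"
    and measurable_history: "s \<le> t \<Longrightarrow> Z s \<in> borel_measurable (history P Z t)"
proof -
  define A where "A = {Z s -` A \<inter> space P |s A. s \<le> t \<and> A \<in> sets borel}"
  have A: "A \<subseteq> sets P" unfolding A_def using Z by (auto intro: measurable_sets)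
  then have A': "A \<subseteq> Pow (space P)" using sets.space_closed by blast
  show "subalgebra P (history P Z t)"
    unfolding subalgebra_def history_def A_def[symmetric]
    using A' sets.sigma_sets_subset[OF A] by (simp add: space_measure_of_conv)
  show "Z s \<in> borel_measurable (history P Z t)" if "s \<le> t"
  proof (rule measurableI)
    fix B :: "'z set" assume "B \<in> sets borel"
    then have "Z s -` B \<inter> space P \<in> A" using that unfolding A_def by blast
    then show "Z s -` B \<inter> space (history P Z t) \<in> sets (history P Z t)"
      unfolding history_def A_def[symmetric] using A' by (simp add: space_measure_of_conv)
  qed simp
qed

text \<open>The witness is the mean itself; by Jensen its norm is at most the root of the second moment.\<close>

lemma estimator_mean_bounded:
  assumes P: "prob_space P" and est: "estimator_of P M g S" and M: "M > 0"
  shows "\<exists>v\<in>S. norm v \<le> M"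
proof -
  interpret prob_space P by (rule P)
  have g: "g \<in> borel_measurable P" and S: "(\<integral>\<omega>. g \<omega> \<partial>P) \<in> S"
    and le: "(\<integral>\<^sup>+\<omega>. ennreal ((norm (g \<omega>))\<^sup>2) \<partial>P) \<le> ennreal (M\<^sup>2)"
    using est by (auto simp: estimator_of_def)
  have "norm (\<integral>\<omega>. g \<omega> \<partial>P) \<le> (\<integral>\<omega>. norm (g \<omega>) \<partial>P)" by (rule integral_norm_bound)
  also have "\<dots> \<le> ((\<integral>\<omega>. (norm (g \<omega>))\<^sup>2 \<partial>P) / M + M) / 2"
    by (rule first_moment_le[OF square_integrable_of_second_moment[OF g le] M])
  also have "\<dots> \<le> (M\<^sup>2 / M + M) / 2"
    using second_moment_le[OF g le] M by (intro divide_right_mono add_right_mono) auto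
  also have "\<dots> = M" using M by (simp add: power2_eq_square)
  finally show ?thesis using S by blast
qed

lemma random_index_measurable:
  fixes f :: "nat \<Rightarrow> 'w \<Rightarrow> 'a::euclidean_space"
  assumes "\<And>t. t < T \<Longrightarrow> f t \<in> borel_measurable P"
  shows "(\<lambda>(\<omega>, t). f t \<omega>) \<in> borel_measurable (P \<Otimes>\<^sub>M uniform_count_measure {..<T})"
proof -
  have "(\<lambda>z. f (snd z) (fst z)) \<in> borel_measurable (P \<Otimes>\<^sub>M uniform_count_measure {..<T})"
  proof (rule measurable_compose_countable'[where f = "\<lambda>t z. f t (fst z)" and g = snd and I = "{..<T}"])
    show "snd \<in> P \<Otimes>\<^sub>M uniform_count_measure {..<T} \<rightarrow>\<^sub>M count_space {..<T}"
      by measurable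
  qed (use assms in \<open>auto intro: measurable_compose[OF measurable_fst]\<close>)
  then show ?thesis by (simp add: case_prod_beta')
qed

lemma random_index_integral:
  fixes f :: "nat \<Rightarrow> 'w \<Rightarrow> real"
  assumes P: "prob_space P" and T: "T \<ge> 1" and f: "\<And>t. t < T \<Longrightarrow> integrable P (f t)"
  shows "integrable (P \<Otimes>\<^sub>M uniform_count_measure {..<T}) (\<lambda>(\<omega>, t). f t \<omega>)"
    and "(\<integral>(\<omega>, t). f t \<omega> \<partial>(P \<Otimes>\<^sub>M uniform_count_measure {..<T})) = 1 / real T * (\<Sum>t<T. \<integral>\<omega>. f t \<omega> \<partial>P)"
proof -
  interpret P: prob_space P by (rule P)
  interpret U: prob_space "uniform_count_measure {..<T}"
    using T by (intro prob_space_uniform_count_measure) (auto simp: lessThan_empty_iff)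
  interpret PU: pair_sigma_finite P "uniform_count_measure {..<T}" ..
  show int: "integrable (P \<Otimes>\<^sub>M uniform_count_measure {..<T}) (\<lambda>(\<omega>, t). f t \<omega>)"
  proof (rule PU.Fubini_integrable)
    show "(\<lambda>(\<omega>, t). f t \<omega>) \<in> borel_measurable (P \<Otimes>\<^sub>M uniform_count_measure {..<T})"
      using f by (intro random_index_measurable) auto
    show "integrable P (\<lambda>\<omega>. \<integral>t. norm (case (\<omega>, t) of (\<omega>, t) \<Rightarrow> f t \<omega>) \<partial>uniform_count_measure {..<T})"
      using f by (auto simp: integral_uniform_count_measure intro!: integrable_divide
          Bochner_Integration.integrable_sum integrable_abs)
    show "AE \<omega> in P. integrable (uniform_count_measure {..<T}) (\<lambda>t. case (\<omega>, t) of (\<omega>, t) \<Rightarrow> f t \<omega>)"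
      by (simp add: uniform_count_measure_def integrable_point_measure_finite)
  qed
  show "(\<integral>(\<omega>, t). f t \<omega> \<partial>(P \<Otimes>\<^sub>M uniform_count_measure {..<T})) = 1 / real T * (\<Sum>t<T. \<integral>\<omega>. f t \<omega> \<partial>P)"
    using PU.integral_snd[OF int] by (simp add: integral_uniform_count_measure)
qed

text \<open>Trades half of the contraction rate for a displacement \<open>d\<close> of the target.  The weaker rate \<open>k\<close> on
the right covers the case \<open>2 * e > 1\<close>, in which the left-hand side is not positive; there
\<open>1 - k\<close> still has to be nonnegative, whereas \<open>1 - e\<close> might not be.\<close>

lemma young_contraction:
  fixes u d :: "'a::real_inner" and e k :: real
  assumes e: "e > 0" and k: "k \<le> e" "k \<le> 1"
  shows "(1 - 2 * e) * (norm (u + d))\<^sup>2 \<le> (1 - k) * (norm u)\<^sup>2 + (norm d)\<^sup>2 / e"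
proof (cases "1 - 2 * e \<le> 0")
  case True
  then have "(1 - 2 * e) * (norm (u + d))\<^sup>2 \<le> 0" by (simp add: mult_nonpos_nonneg)
  also have "0 \<le> (1 - k) * (norm u)\<^sup>2 + (norm d)\<^sup>2 / e" using e k by simp
  finally show ?thesis .
next
  case False
  have "0 \<le> (norm (e *\<^sub>R u - d))\<^sup>2" by simp
  also have "\<dots> = e\<^sup>2 * (norm u)\<^sup>2 - 2 * e * (u \<bullet> d) + (norm d)\<^sup>2"
    unfolding power2_norm_eq_inner
    by (simp add: inner_diff_left inner_diff_right inner_commute power2_eq_square algebra_simps)
  finally have "2 * e * (u \<bullet> d) \<le> e\<^sup>2 * (norm u)\<^sup>2 + (norm d)\<^sup>2" by simp
  then have ud: "2 * (u \<bullet> d) \<le> e * (norm u)\<^sup>2 + (norm d)\<^sup>2 / e"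
    using e by (simp add: field_simps power2_eq_square)
  have "(norm (u + d))\<^sup>2 = (norm u)\<^sup>2 + 2 * (u \<bullet> d) + (norm d)\<^sup>2"
    by (simp add: power2_norm_eq_inner inner_add_left inner_add_right inner_commute)
  also have "\<dots> \<le> (1 + e) * (norm u)\<^sup>2 + (1 + 1 / e) * (norm d)\<^sup>2"
    using ud by (simp add: algebra_simps)
  finally have "(1 - 2 * e) * (norm (u + d))\<^sup>2
      \<le> (1 - 2 * e) * ((1 + e) * (norm u)\<^sup>2 + (1 + 1 / e) * (norm d)\<^sup>2)"
    using False by (intro mult_left_mono) auto
  also have "\<dots> = (1 - e - 2 * e\<^sup>2) * (norm u)\<^sup>2 + (1 / e - 1 - 2 * e) * (norm d)\<^sup>2"
    using e by (simp add: field_simps power2_eq_square)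
  also have "\<dots> \<le> (1 - k) * (norm u)\<^sup>2 + 1 / e * (norm d)\<^sup>2"
    using e k zero_le_power2[of e] by (intro add_mono mult_right_mono) (linarith | simp)+
  finally show ?thesis by simp
qed

section \<open>The iterates as square-integrable random vectors\<close>

locale smag_iteration = wcsc_proximal Y \<phi> grad_y \<delta> \<mu> L M \<gamma> + prob_space P
  for Y :: "'b::euclidean_space set" and \<phi> :: "'a::euclidean_space \<Rightarrow> 'b \<Rightarrow> real"
    and grad_y :: "'a \<Rightarrow> 'b \<Rightarrow> 'b" and \<delta> \<mu> L M \<gamma> :: real and P :: "'w measure" +
  fixes gx :: "nat \<Rightarrow> 'a \<Rightarrow> 'b \<Rightarrow> 'w \<Rightarrow> 'a" and gy :: "nat \<Rightarrow> 'a \<Rightarrow> 'b \<Rightarrow> 'w \<Rightarrow> 'b"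
    and x\<phi> x G :: "nat \<Rightarrow> 'w \<Rightarrow> 'a" and y :: "nat \<Rightarrow> 'w \<Rightarrow> 'b"
    and x\<phi>0 x0 :: 'a and y0 :: 'b and \<eta>0 \<eta>1 :: real and T :: nat
  assumes y0_in: "y0 \<in> Y"
    and run: "smag_run P Y gx gy \<gamma> \<eta>0 \<eta>1 T x\<phi>0 x0 y0 x\<phi> x y G"
    and est_x: "\<And>t. t < T \<Longrightarrow> cond_estimator_of P (history P (\<lambda>s \<omega>. (x\<phi> s \<omega>, x s \<omega>, y s \<omega>)) t) M
                 (\<lambda>\<omega>. gx t (x\<phi> t \<omega>) (y t \<omega>) \<omega>)
                 (\<lambda>\<omega>. subdifferential (\<lambda>x. \<phi> x (y t \<omega>)) (x\<phi> t \<omega>))"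
    and est_y: "\<And>t. t < T \<Longrightarrow> cond_estimator_of P (history P (\<lambda>s \<omega>. (x\<phi> s \<omega>, x s \<omega>, y s \<omega>)) t) M
                 (\<lambda>\<omega>. gy t (x\<phi> t \<omega>) (y t \<omega>) \<omega>)
                 (\<lambda>\<omega>. {grad_y (x\<phi> t \<omega>) (y t \<omega>)})"
    and \<eta>0_pos: "\<eta>0 > 0" and \<eta>1_pos: "\<eta>1 > 0"
    and \<eta>1_small: "\<eta>1 \<le> \<gamma>\<^sup>2 * (1 / \<gamma> - \<delta>) / 2"
    and \<eta>0_small: "\<eta>0 \<le> \<gamma> / 4"
begin

abbreviation hist :: "nat \<Rightarrow> 'w measure" where
  "hist t \<equiv> history P (\<lambda>s \<omega>. (x\<phi> s \<omega>, x s \<omega>, y s \<omega>)) t"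

definition sub_est :: "nat \<Rightarrow> 'w \<Rightarrow> 'a" where "sub_est t \<omega> = gx t (x\<phi> t \<omega>) (y t \<omega>) \<omega>"
definition grad_est :: "nat \<Rightarrow> 'w \<Rightarrow> 'b" where "grad_est t \<omega> = gy t (x\<phi> t \<omega>) (y t \<omega>) \<omega>"

lemma run_init:
  assumes "\<omega> \<in> space P"
  shows "x\<phi> 0 \<omega> = x\<phi>0" "x 0 \<omega> = x0" "y 0 \<omega> = y0"
  using run assms unfolding smag_run_def by auto

lemma run_step:
  assumes "\<omega> \<in> space P" "t < T"
  shows "x\<phi> (Suc t) \<omega> = x\<phi> t \<omega> - \<eta>1 *\<^sub>R (sub_est t \<omega> + (1 / \<gamma>) *\<^sub>R (x\<phi> t \<omega> - x t \<omega>))"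
    "y (Suc t) \<omega> = closest_point Y (y t \<omega> + \<eta>1 *\<^sub>R grad_est t \<omega>)"
    "G (Suc t) \<omega> = (1 / \<gamma>) *\<^sub>R (x t \<omega> - x\<phi> (Suc t) \<omega>)"
    "x (Suc t) \<omega> = x t \<omega> - \<eta>0 *\<^sub>R G (Suc t) \<omega>"
  using run assms unfolding smag_run_def sub_est_def grad_est_def by auto

lemma sub_est_measurable: "t < T \<Longrightarrow> sub_est t \<in> borel_measurable P"
  using est_x unfolding cond_estimator_of_def sub_est_def[abs_def] by auto

lemma grad_est_measurable: "t < T \<Longrightarrow> grad_est t \<in> borel_measurable P"
  using est_y unfolding cond_estimator_of_def grad_est_def[abs_def] by auto

lemma y_in: "\<lbrakk>\<omega> \<in> space P; t \<le> T\<rbrakk> \<Longrightarrow> y t \<omega> \<in> Y"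
proof (cases t)
  case (Suc s)
  assume "\<omega> \<in> space P" "t \<le> T"
  then show ?thesis
    unfolding Suc using run_step(2)[of \<omega> s] closest_point_in_set[OF compact_imp_closed[OF Y_compact] Y_ne] by simp
qed (simp add: run_init y0_in)

lemma iterates_measurable:
  "t \<le> T \<Longrightarrow> x\<phi> t \<in> borel_measurable P \<and> x t \<in> borel_measurable P \<and> y t \<in> borel_measurable P"
proof (induction t)
  case 0
  have "x\<phi> 0 \<in> borel_measurable P \<longleftrightarrow> (\<lambda>_. x\<phi>0) \<in> borel_measurable P"
    "x 0 \<in> borel_measurable P \<longleftrightarrow> (\<lambda>_. x0) \<in> borel_measurable P"
    "y 0 \<in> borel_measurable P \<longleftrightarrow> (\<lambda>_. y0) \<in> borel_measurable P"
    by (rule measurable_cong; simp add: run_init)+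
  then show ?case by simp
next
  case (Suc t)
  then have t: "t < T"
    and [measurable]: "x\<phi> t \<in> borel_measurable P" "x t \<in> borel_measurable P" "y t \<in> borel_measurable P" by auto
  note [measurable] = sub_est_measurable[OF t] grad_est_measurable[OF t]
  have [measurable]: "closest_point Y \<in> borel_measurable borel"
    by (intro borel_measurable_continuous_onI continuous_on_closest_point Y_convex Y_ne compact_imp_closed Y_compact)
  have "x\<phi> (Suc t) \<in> borel_measurable P \<longleftrightarrow>
      (\<lambda>\<omega>. x\<phi> t \<omega> - \<eta>1 *\<^sub>R (sub_est t \<omega> + (1 / \<gamma>) *\<^sub>R (x\<phi> t \<omega> - x t \<omega>))) \<in> borel_measurable P"
    by (rule measurable_cong) (simp add: run_step(1)[OF _ t])
  then have 1[measurable]: "x\<phi> (Suc t) \<in> borel_measurable P" by simp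
  have "y (Suc t) \<in> borel_measurable P \<longleftrightarrow> (\<lambda>\<omega>. closest_point Y (y t \<omega> + \<eta>1 *\<^sub>R grad_est t \<omega>)) \<in> borel_measurable P"
    by (rule measurable_cong) (simp add: run_step(2)[OF _ t])
  then have 2: "y (Suc t) \<in> borel_measurable P" by simp
  have "x (Suc t) \<in> borel_measurable P \<longleftrightarrow>
      (\<lambda>\<omega>. x t \<omega> - \<eta>0 *\<^sub>R ((1 / \<gamma>) *\<^sub>R (x t \<omega> - x\<phi> (Suc t) \<omega>))) \<in> borel_measurable P"
    by (rule measurable_cong) (simp add: run_step(3,4)[OF _ t])
  then have 3: "x (Suc t) \<in> borel_measurable P" by simp
  show ?case using 1 2 3 by blast
qed

lemma pair_measurable: "t \<le> T \<Longrightarrow> (\<lambda>\<omega>. (x\<phi> t \<omega>, x t \<omega>, y t \<omega>)) \<in> borel_measurable P"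
  using iterates_measurable by (intro borel_measurable_Pair) auto

lemma history_subalgebra: "t \<le> T \<Longrightarrow> subalgebra P (hist t)"
  by (rule subalgebra_history) (rule pair_measurable, simp)

lemma iterates_measurable_history:
  assumes "t \<le> T"
  shows "x\<phi> t \<in> borel_measurable (hist t)" "x t \<in> borel_measurable (hist t)" "y t \<in> borel_measurable (hist t)"
proof -
  have *: "(\<lambda>\<omega>. (x\<phi> t \<omega>, x t \<omega>, y t \<omega>)) \<in> borel_measurable (hist t)"
    by (rule measurable_history) (use pair_measurable assms in auto)
  have "(\<lambda>\<omega>. fst (x\<phi> t \<omega>, x t \<omega>, y t \<omega>)) \<in> borel_measurable (hist t)"
    "(\<lambda>\<omega>. fst (snd (x\<phi> t \<omega>, x t \<omega>, y t \<omega>))) \<in> borel_measurable (hist t)"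
    "(\<lambda>\<omega>. snd (snd (x\<phi> t \<omega>, x t \<omega>, y t \<omega>))) \<in> borel_measurable (hist t)"
    by (rule measurable_compose[OF *], intro borel_measurable_continuous_onI continuous_intros)+
  then show "x\<phi> t \<in> borel_measurable (hist t)" "x t \<in> borel_measurable (hist t)" "y t \<in> borel_measurable (hist t)"
    by simp_all
qed

lemma sub_est_square_integrable:
  assumes "t < T"
  shows "square_integrable P (sub_est t)" "(\<integral>\<omega>. (norm (sub_est t \<omega>))\<^sup>2 \<partial>P) \<le> M\<^sup>2"
  using cond_second_moment[OF prob_space_axioms history_subalgebra sub_est_measurable, of t t M] est_x[OF assms] assms
  unfolding cond_estimator_of_def sub_est_def[abs_def] by auto

lemma grad_est_square_integrable:
  assumes "t < T"
  shows "square_integrable P (grad_est t)" "(\<integral>\<omega>. (norm (grad_est t \<omega>))\<^sup>2 \<partial>P) \<le> M\<^sup>2"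
  using cond_second_moment[OF prob_space_axioms history_subalgebra grad_est_measurable, of t t M] est_y[OF assms] assms
  unfolding cond_estimator_of_def grad_est_def[abs_def] by auto

lemma iterates_square_integrable:
  "t \<le> T \<Longrightarrow> square_integrable P (x\<phi> t) \<and> square_integrable P (x t)"
proof (induction t)
  case 0
  have "norm (x\<phi> 0 \<omega>) \<le> norm x\<phi>0" "norm (x 0 \<omega>) \<le> norm x0" if "\<omega> \<in> space P" for \<omega>
    using that by (simp_all add: run_init)
  then show ?case using iterates_measurable[of 0] by (auto intro: square_integrable_bounded)
next
  case (Suc t)
  then have t: "t < T" and IH: "square_integrable P (x\<phi> t)" "square_integrable P (x t)" by auto
  have "square_integrable P (x\<phi> (Suc t)) =
      square_integrable P (\<lambda>\<omega>. x\<phi> t \<omega> - \<eta>1 *\<^sub>R (sub_est t \<omega> + (1 / \<gamma>) *\<^sub>R (x\<phi> t \<omega> - x t \<omega>)))"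
    by (rule square_integrable_cong) (simp add: run_step(1)[OF _ t])
  then have 1: "square_integrable P (x\<phi> (Suc t))"
    by (simp add: square_integrable_diff square_integrable_add square_integrable_scaleR IH sub_est_square_integrable[OF t])
  have "square_integrable P (x (Suc t)) =
      square_integrable P (\<lambda>\<omega>. x t \<omega> - \<eta>0 *\<^sub>R ((1 / \<gamma>) *\<^sub>R (x t \<omega> - x\<phi> (Suc t) \<omega>)))"
    by (rule square_integrable_cong) (simp add: run_step(3,4)[OF _ t])
  then have 2: "square_integrable P (x (Suc t))"
    by (simp only: square_integrable_diff square_integrable_scaleR IH 1)
  show ?case using 1 2 by blast
qed

lemma env_grad_x_measurable: "t \<le> T \<Longrightarrow> (\<lambda>\<omega>. env_grad (x t \<omega>)) \<in> borel_measurable P"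
  using iterates_measurable borel_measurable_continuous_onI[OF env_grad_continuous]
  by (blast intro: measurable_compose)

lemma env_grad_x_square_integrable: "t \<le> T \<Longrightarrow> square_integrable P (\<lambda>\<omega>. env_grad (x t \<omega>))"
  by (rule square_integrable_bounded[OF env_grad_x_measurable]) (auto intro: env_grad_bound)

lemma pr_x_square_integrable: "t \<le> T \<Longrightarrow> square_integrable P (\<lambda>\<omega>. pr (x t \<omega>))"
  unfolding pr_env_grad
  by (intro square_integrable_diff square_integrable_scaleR env_grad_x_square_integrable)
     (use iterates_square_integrable in auto)

lemma Y_bound: "\<exists>B. \<forall>y\<in>Y. norm y \<le> B"
  using compact_imp_bounded[OF Y_compact] unfolding bounded_iff .

lemma y_square_integrable: "t \<le> T \<Longrightarrow> square_integrable P (y t)"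
  using Y_bound y_in iterates_measurable by (metis square_integrable_bounded)

lemma ys_pr_measurable: "(\<lambda>z. ys (pr z)) \<in> borel_measurable borel"
  using continuous_on_compose2[OF ys_continuous pr_continuous]
  by (intro borel_measurable_continuous_onI) auto

lemma ys_x_square_integrable:
  assumes "t \<le> T"
  shows "square_integrable P (\<lambda>\<omega>. ys (pr (x t \<omega>)))"
proof -
  obtain B where B: "\<forall>y\<in>Y. norm y \<le> B" using Y_bound by blast
  show ?thesis
    by (rule square_integrable_bounded[where B = B])
      (use iterates_measurable[OF assms] measurable_compose[OF _ ys_pr_measurable] B ys_in in auto)
qed

text \<open>Distances of the fast iterates to the saddle point that belongs to the slow iterate \<open>x t\<close>: \<open>pre\<close>
before and \<open>post\<close> after the fast iterates are updated in iteration \<open>t\<close>.  From one iteration to the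
next, \<open>post\<close> at \<open>t\<close> and \<open>pre\<close> at \<open>Suc t\<close> differ by the movement of the saddle point.\<close>

definition post_x :: "nat \<Rightarrow> 'w \<Rightarrow> 'a" where "post_x t \<omega> = x\<phi> (Suc t) \<omega> - pr (x t \<omega>)"
definition post_y :: "nat \<Rightarrow> 'w \<Rightarrow> 'b" where "post_y t \<omega> = y (Suc t) \<omega> - ys (pr (x t \<omega>))"
definition pre_x :: "nat \<Rightarrow> 'w \<Rightarrow> 'a" where "pre_x t \<omega> = x\<phi> t \<omega> - pr (x t \<omega>)"
definition pre_y :: "nat \<Rightarrow> 'w \<Rightarrow> 'b" where "pre_y t \<omega> = y t \<omega> - ys (pr (x t \<omega>))"

lemma gaps_square_integrable:
  shows "t < T \<Longrightarrow> square_integrable P (post_x t)" "t < T \<Longrightarrow> square_integrable P (post_y t)"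
    "t \<le> T \<Longrightarrow> square_integrable P (pre_x t)" "t \<le> T \<Longrightarrow> square_integrable P (pre_y t)"
  unfolding post_x_def[abs_def] post_y_def[abs_def] pre_x_def[abs_def] pre_y_def[abs_def]
  using iterates_square_integrable y_square_integrable
  by (auto intro!: square_integrable_diff pr_x_square_integrable ys_x_square_integrable)

lemma pre_x_measurable_history: "t \<le> T \<Longrightarrow> pre_x t \<in> borel_measurable (hist t)"
  unfolding pre_x_def[abs_def]
  using iterates_measurable_history borel_measurable_continuous_onI[OF pr_continuous]
  by (intro borel_measurable_diff) (auto intro: measurable_compose)

lemma pre_y_measurable_history: "t \<le> T \<Longrightarrow> pre_y t \<in> borel_measurable (hist t)"
  unfolding pre_y_def[abs_def]
  using iterates_measurable_history ys_pr_measurable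
  by (intro borel_measurable_diff) (auto intro: measurable_compose)

lemma cond_mean_x:
  assumes "t < T"
  shows "integrable P (\<lambda>\<omega>. pre_x t \<omega> \<bullet> vec_cond_exp P (hist t) (sub_est t) \<omega>)"
    and "(\<integral>\<omega>. pre_x t \<omega> \<bullet> vec_cond_exp P (hist t) (sub_est t) \<omega> \<partial>P) = (\<integral>\<omega>. pre_x t \<omega> \<bullet> sub_est t \<omega> \<partial>P)"
    and "AE \<omega> in P. vec_cond_exp P (hist t) (sub_est t) \<omega> \<in> subdifferential (\<lambda>x. \<phi> x (y t \<omega>)) (x\<phi> t \<omega>)"
proof -
  interpret S: finite_measure_subalgebra P "hist t"
    using history_subalgebra assms by unfold_locales auto
  show "integrable P (\<lambda>\<omega>. pre_x t \<omega> \<bullet> vec_cond_exp P (hist t) (sub_est t) \<omega>)"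
    and "(\<integral>\<omega>. pre_x t \<omega> \<bullet> vec_cond_exp P (hist t) (sub_est t) \<omega> \<partial>P) = (\<integral>\<omega>. pre_x t \<omega> \<bullet> sub_est t \<omega> \<partial>P)"
    using S.vec_cond_exp_inner[OF pre_x_measurable_history gaps_square_integrable(3) sub_est_square_integrable(1)] assms by auto
  show "AE \<omega> in P. vec_cond_exp P (hist t) (sub_est t) \<omega> \<in> subdifferential (\<lambda>x. \<phi> x (y t \<omega>)) (x\<phi> t \<omega>)"
    using est_x[OF assms] unfolding cond_estimator_of_def sub_est_def[abs_def] by blast
qed

lemma cond_mean_y:
  assumes "t < T"
  shows "integrable P (\<lambda>\<omega>. pre_y t \<omega> \<bullet> vec_cond_exp P (hist t) (grad_est t) \<omega>)"
    and "(\<integral>\<omega>. pre_y t \<omega> \<bullet> vec_cond_exp P (hist t) (grad_est t) \<omega> \<partial>P) = (\<integral>\<omega>. pre_y t \<omega> \<bullet> grad_est t \<omega> \<partial>P)"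
    and "AE \<omega> in P. vec_cond_exp P (hist t) (grad_est t) \<omega> = grad_y (x\<phi> t \<omega>) (y t \<omega>)"
proof -
  interpret S: finite_measure_subalgebra P "hist t"
    using history_subalgebra assms by unfold_locales auto
  show "integrable P (\<lambda>\<omega>. pre_y t \<omega> \<bullet> vec_cond_exp P (hist t) (grad_est t) \<omega>)"
    and "(\<integral>\<omega>. pre_y t \<omega> \<bullet> vec_cond_exp P (hist t) (grad_est t) \<omega> \<partial>P) = (\<integral>\<omega>. pre_y t \<omega> \<bullet> grad_est t \<omega> \<partial>P)"
    using S.vec_cond_exp_inner[OF pre_y_measurable_history gaps_square_integrable(4) grad_est_square_integrable(1)] assms by auto
  show "AE \<omega> in P. vec_cond_exp P (hist t) (grad_est t) \<omega> = grad_y (x\<phi> t \<omega>) (y t \<omega>)"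
    using est_y[OF assms] unfolding cond_estimator_of_def grad_est_def[abs_def] by simp
qed

section \<open>One step of stochastic gradient descent ascent\<close>

text \<open>The gradient \<open>k = (1 / \<gamma>) *\<^sub>R (x\<phi> t \<omega> - x t \<omega>)\<close> of the quadratic term is unbounded.  Writing it as
\<open>(1 / \<gamma>) *\<^sub>R pre_x t \<omega> - env_grad (x t \<omega>)\<close> splits it into a part whose square is, by the step size
condition, at most the share \<open>\<eta>1 * \<rho>\<close> of the squared gap, and a part of norm at most \<open>M\<close>.\<close>

lemma post_x_sq_le:
  assumes \<omega>: "\<omega> \<in> space P" and t: "t < T"
  shows "(norm (post_x t \<omega>))\<^sup>2 \<le> (1 + \<eta>1 * \<rho>) * (norm (pre_x t \<omega>))\<^sup>2
     - 2 * \<eta>1 * (pre_x t \<omega> \<bullet> sub_est t \<omega>) - 2 * \<eta>1 * (pre_x t \<omega> \<bullet> ((1 / \<gamma>) *\<^sub>R (x\<phi> t \<omega> - x t \<omega>)))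
     + 4 * \<eta>1\<^sup>2 * (norm (sub_est t \<omega>))\<^sup>2 + 4 * \<eta>1\<^sup>2 * M\<^sup>2"
proof -
  define a g w k where "a = pre_x t \<omega>" and "g = sub_est t \<omega>" and "w = env_grad (x t \<omega>)"
    and "k = (1 / \<gamma>) *\<^sub>R (x\<phi> t \<omega> - x t \<omega>)"
  have k: "k = (1 / \<gamma>) *\<^sub>R a - w"
    by (simp add: k_def a_def pre_x_def w_def env_grad_def algebra_simps)
  have post_x: "post_x t \<omega> = a - \<eta>1 *\<^sub>R (g + k)"
    unfolding post_x_def run_step(1)[OF \<omega> t] a_def g_def k_def pre_x_def by simp
  have "(norm (post_x t \<omega>))\<^sup>2 = (norm a)\<^sup>2 - 2 * \<eta>1 * (a \<bullet> (g + k)) + \<eta>1\<^sup>2 * (norm (g + k))\<^sup>2"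
    unfolding post_x power2_norm_eq_inner
    by (simp add: inner_diff_left inner_diff_right inner_commute power2_eq_square algebra_simps)
  moreover have "(norm (g + k))\<^sup>2 \<le> 4 * (norm g)\<^sup>2 + 4 * M\<^sup>2 + 2 / \<gamma>\<^sup>2 * (norm a)\<^sup>2"
  proof -
    have "(norm (g + k))\<^sup>2 \<le> 2 * (norm (g + - w))\<^sup>2 + 2 * (norm ((1 / \<gamma>) *\<^sub>R a))\<^sup>2"
      using norm_add_sq_le[of "g + - w" "(1 / \<gamma>) *\<^sub>R a"] by (simp add: k algebra_simps)
    moreover have "(norm (g + - w))\<^sup>2 \<le> 2 * (norm g)\<^sup>2 + 2 * (norm w)\<^sup>2"
      using norm_add_sq_le[of g "- w"] by simp
    moreover have "(norm w)\<^sup>2 \<le> M\<^sup>2" unfolding w_def using env_grad_bound by (intro power_mono) auto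
    moreover have "(norm ((1 / \<gamma>) *\<^sub>R a))\<^sup>2 = (norm a)\<^sup>2 / \<gamma>\<^sup>2"
      using \<gamma>_pos by (simp add: power_divide)
    ultimately show ?thesis by simp
  qed
  then have "\<eta>1\<^sup>2 * (norm (g + k))\<^sup>2 \<le> \<eta>1\<^sup>2 * (4 * (norm g)\<^sup>2 + 4 * M\<^sup>2 + 2 / \<gamma>\<^sup>2 * (norm a)\<^sup>2)"
    by (intro mult_left_mono) auto
  moreover have "\<eta>1\<^sup>2 * (2 / \<gamma>\<^sup>2 * (norm a)\<^sup>2) \<le> \<eta>1 * \<rho> * (norm a)\<^sup>2"
  proof -
    have "\<eta>1 * 2 / \<gamma>\<^sup>2 \<le> \<rho>" using \<eta>1_small \<gamma>_pos unfolding \<rho>_def[symmetric] by (simp add: field_simps)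
    then have "\<eta>1 * (\<eta>1 * 2 / \<gamma>\<^sup>2) * (norm a)\<^sup>2 \<le> \<eta>1 * \<rho> * (norm a)\<^sup>2"
      using \<eta>1_pos by (intro mult_right_mono mult_left_mono) auto
    then show ?thesis by (simp add: power2_eq_square)
  qed
  ultimately show ?thesis
    unfolding a_def[symmetric] g_def[symmetric] k_def[symmetric] by (simp add: inner_add_right algebra_simps)
qed

text \<open>The projection onto \<open>Y\<close> is nonexpansive and fixes the maximizer.\<close>

lemma post_y_sq_le:
  assumes \<omega>: "\<omega> \<in> space P" and t: "t < T"
  shows "(norm (post_y t \<omega>))\<^sup>2 \<le> (norm (pre_y t \<omega>))\<^sup>2 + 2 * \<eta>1 * (pre_y t \<omega> \<bullet> grad_est t \<omega>) + \<eta>1\<^sup>2 * (norm (grad_est t \<omega>))\<^sup>2"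
proof -
  have closed: "closed Y" using Y_compact by (rule compact_imp_closed)
  have "norm (post_y t \<omega>) \<le> norm (pre_y t \<omega> + \<eta>1 *\<^sub>R grad_est t \<omega>)"
    using closest_point_lipschitz[OF Y_convex closed Y_ne, of "y t \<omega> + \<eta>1 *\<^sub>R grad_est t \<omega>" "ys (pr (x t \<omega>))"]
      closest_point_self[OF ys_in]
    unfolding post_y_def pre_y_def run_step(2)[OF \<omega> t] by (simp add: dist_norm algebra_simps)
  then have "(norm (post_y t \<omega>))\<^sup>2 \<le> (norm (pre_y t \<omega> + \<eta>1 *\<^sub>R grad_est t \<omega>))\<^sup>2" by (rule power_mono) simp
  also have "\<dots> = (norm (pre_y t \<omega>))\<^sup>2 + 2 * \<eta>1 * (pre_y t \<omega> \<bullet> grad_est t \<omega>) + \<eta>1\<^sup>2 * (norm (grad_est t \<omega>))\<^sup>2"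
    unfolding power2_norm_eq_inner
    by (simp add: inner_add_left inner_add_right inner_commute power2_eq_square algebra_simps)
  finally show ?thesis .
qed

definition \<Delta> :: "nat \<Rightarrow> real" where
  "\<Delta> t = (\<integral>\<omega>. (norm (post_x t \<omega>))\<^sup>2 \<partial>P) + (\<integral>\<omega>. (norm (post_y t \<omega>))\<^sup>2 \<partial>P)"

text \<open>In the mean the estimators become a subgradient and a gradient, and the strong monotonicity of the
saddle operator turns their inner products with the gaps into the two contraction factors.  The
constant is \<open>9 = 4 + 4 + 1\<close>: four from the subgradient estimator, four from the envelope gradient at
\<open>x t\<close>, one from the \<open>y\<close>-gradient estimator.\<close>

lemma one_step:
  assumes t: "t < T"
  shows "\<Delta> t \<le> (\<integral>\<omega>. (1 - \<eta>1 * \<rho>) * (norm (pre_x t \<omega>))\<^sup>2 + (1 - 2 * \<eta>1 * \<mu>) * (norm (pre_y t \<omega>))\<^sup>2 \<partial>P) + 9 * \<eta>1\<^sup>2 * M\<^sup>2"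
proof -
  define vx vy where "vx = vec_cond_exp P (hist t) (sub_est t)" and "vy = vec_cond_exp P (hist t) (grad_est t)"
  define k where "k \<omega> = (1 / \<gamma>) *\<^sub>R (x\<phi> t \<omega> - x t \<omega>)" for \<omega>
  have sq: "square_integrable P (pre_x t)" "square_integrable P (pre_y t)" "square_integrable P (sub_est t)"
      "square_integrable P (grad_est t)" "square_integrable P (post_x t)" "square_integrable P (post_y t)"
    using t by (auto intro: gaps_square_integrable sub_est_square_integrable grad_est_square_integrable)
  have kq: "square_integrable P k" unfolding k_def[abs_def]
    using t iterates_square_integrable[of t] by (intro square_integrable_scaleR square_integrable_diff) auto
  note ints[intro, simp] = sq[THEN norm_sq_integrable]
    square_integrable_inner[OF sq(1) sq(3)] square_integrable_inner[OF sq(2) sq(4)]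
    square_integrable_inner[OF sq(1) kq]
    cond_mean_x(1)[OF t, folded vx_def] cond_mean_y(1)[OF t, folded vy_def]
  \<comment> \<open>\<open>R\<close> collects the terms that are known before the estimators are drawn.\<close>
  define R where "R \<omega> = (1 + \<eta>1 * \<rho>) * (norm (pre_x t \<omega>))\<^sup>2 - 2 * \<eta>1 * (pre_x t \<omega> \<bullet> k \<omega>) + (norm (pre_y t \<omega>))\<^sup>2" for \<omega>
  have R[intro, simp]: "integrable P R" unfolding R_def by auto
  have "\<Delta> t = (\<integral>\<omega>. (norm (post_x t \<omega>))\<^sup>2 + (norm (post_y t \<omega>))\<^sup>2 \<partial>P)"
    unfolding \<Delta>_def by simp
  also have "\<dots> \<le> (\<integral>\<omega>. R \<omega> - 2 * \<eta>1 * (pre_x t \<omega> \<bullet> sub_est t \<omega>) + 2 * \<eta>1 * (pre_y t \<omega> \<bullet> grad_est t \<omega>)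
      + 4 * \<eta>1\<^sup>2 * (norm (sub_est t \<omega>))\<^sup>2 + \<eta>1\<^sup>2 * (norm (grad_est t \<omega>))\<^sup>2 + 4 * \<eta>1\<^sup>2 * M\<^sup>2 \<partial>P)"
  proof (rule integral_mono)
    fix \<omega> assume \<omega>: "\<omega> \<in> space P"
    show "(norm (post_x t \<omega>))\<^sup>2 + (norm (post_y t \<omega>))\<^sup>2 \<le> R \<omega> - 2 * \<eta>1 * (pre_x t \<omega> \<bullet> sub_est t \<omega>)
      + 2 * \<eta>1 * (pre_y t \<omega> \<bullet> grad_est t \<omega>)
      + 4 * \<eta>1\<^sup>2 * (norm (sub_est t \<omega>))\<^sup>2 + \<eta>1\<^sup>2 * (norm (grad_est t \<omega>))\<^sup>2 + 4 * \<eta>1\<^sup>2 * M\<^sup>2"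
      using post_x_sq_le[OF \<omega> t] post_y_sq_le[OF \<omega> t] unfolding R_def k_def by linarith
  qed auto
  also have "\<dots> = (\<integral>\<omega>. R \<omega> \<partial>P) - 2 * \<eta>1 * (\<integral>\<omega>. pre_x t \<omega> \<bullet> sub_est t \<omega> \<partial>P) + 2 * \<eta>1 * (\<integral>\<omega>. pre_y t \<omega> \<bullet> grad_est t \<omega> \<partial>P)
      + 4 * \<eta>1\<^sup>2 * (\<integral>\<omega>. (norm (sub_est t \<omega>))\<^sup>2 \<partial>P) + \<eta>1\<^sup>2 * (\<integral>\<omega>. (norm (grad_est t \<omega>))\<^sup>2 \<partial>P) + 4 * \<eta>1\<^sup>2 * M\<^sup>2"
    by (simp add: prob_space)
  also have "\<dots> \<le> (\<integral>\<omega>. R \<omega> \<partial>P) - 2 * \<eta>1 * (\<integral>\<omega>. pre_x t \<omega> \<bullet> vx \<omega> \<partial>P) + 2 * \<eta>1 * (\<integral>\<omega>. pre_y t \<omega> \<bullet> vy \<omega> \<partial>P)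
      + 4 * \<eta>1\<^sup>2 * M\<^sup>2 + \<eta>1\<^sup>2 * M\<^sup>2 + 4 * \<eta>1\<^sup>2 * M\<^sup>2"
    unfolding vx_def vy_def cond_mean_x(2)[OF t] cond_mean_y(2)[OF t]
    using sub_est_square_integrable(2)[OF t] grad_est_square_integrable(2)[OF t]
    by (intro add_mono mult_left_mono order_refl) auto
  also have "\<dots> = (\<integral>\<omega>. R \<omega> - 2 * \<eta>1 * (pre_x t \<omega> \<bullet> vx \<omega>) + 2 * \<eta>1 * (pre_y t \<omega> \<bullet> vy \<omega>) \<partial>P) + 9 * \<eta>1\<^sup>2 * M\<^sup>2"
    by simp
  also have "(\<integral>\<omega>. R \<omega> - 2 * \<eta>1 * (pre_x t \<omega> \<bullet> vx \<omega>) + 2 * \<eta>1 * (pre_y t \<omega> \<bullet> vy \<omega>) \<partial>P)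
     \<le> (\<integral>\<omega>. (1 - \<eta>1 * \<rho>) * (norm (pre_x t \<omega>))\<^sup>2 + (1 - 2 * \<eta>1 * \<mu>) * (norm (pre_y t \<omega>))\<^sup>2 \<partial>P)"
  proof (rule integral_mono_AE)
    show "AE \<omega> in P. R \<omega> - 2 * \<eta>1 * (pre_x t \<omega> \<bullet> vx \<omega>) + 2 * \<eta>1 * (pre_y t \<omega> \<bullet> vy \<omega>)
      \<le> (1 - \<eta>1 * \<rho>) * (norm (pre_x t \<omega>))\<^sup>2 + (1 - 2 * \<eta>1 * \<mu>) * (norm (pre_y t \<omega>))\<^sup>2"
      using cond_mean_x(3)[OF t, folded vx_def] cond_mean_y(3)[OF t, folded vy_def] AE_space
    proof eventually_elim
      case (elim \<omega>)
      have "pre_x t \<omega> \<bullet> (vx \<omega> + k \<omega>) - pre_y t \<omega> \<bullet> vy \<omega> \<ge> \<rho> * (norm (pre_x t \<omega>))\<^sup>2 + \<mu> * (norm (pre_y t \<omega>))\<^sup>2"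
        using saddle_strong_monotonicity[OF y_in[OF elim(3)] elim(1), of "x t \<omega>"] t
        unfolding pre_x_def pre_y_def k_def elim(2) by simp
      from mult_left_mono[OF this, of "2 * \<eta>1"] \<eta>1_pos
      show ?case unfolding R_def by (simp add: inner_add_right algebra_simps)
    qed
  qed auto
  finally show ?thesis by simp
qed

section \<open>Drift of the saddle point and the Lyapunov bound\<close>

text \<open>\<open>env_upper\<close> along the step \<open>- \<eta>0 *\<^sub>R G\<close>, where the polarization identity expresses the inner product of
the envelope gradient with \<open>G\<close> through their difference \<open>(1 / \<gamma>) *\<^sub>R post_x t \<omega>\<close>.  The bound
\<open>\<eta>0 \<le> \<gamma> / 4\<close> leaves \<open>3 / 8\<close> of the term in \<open>G\<close>.\<close>

lemma env_descent:
  assumes \<omega>: "\<omega> \<in> space P" and t: "t < T"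
  shows "env (x (Suc t) \<omega>) \<le> env (x t \<omega>) + \<eta>0 / (2 * \<gamma>\<^sup>2) * (norm (post_x t \<omega>))\<^sup>2
     - \<eta>0 / 2 * (norm (env_grad (x t \<omega>)))\<^sup>2 - 3 / 8 * \<eta>0 * (norm (G (Suc t) \<omega>))\<^sup>2"
proof -
  define w g where "w = env_grad (x t \<omega>)" and "g = G (Suc t) \<omega>"
  have "w - g = (1 / \<gamma>) *\<^sub>R post_x t \<omega>"
    unfolding w_def g_def env_grad_def post_x_def run_step(3)[OF \<omega> t] by (simp add: algebra_simps)
  then have "(norm (w - g))\<^sup>2 = (norm (post_x t \<omega>))\<^sup>2 / \<gamma>\<^sup>2"
    using \<gamma>_pos by (simp add: power_divide)
  moreover have "(norm (w - g))\<^sup>2 = (norm w)\<^sup>2 - 2 * (w \<bullet> g) + (norm g)\<^sup>2"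
    unfolding power2_norm_eq_inner
    by (simp add: inner_diff_left inner_diff_right inner_commute algebra_simps)
  ultimately have wg: "- (w \<bullet> g) = ((norm (post_x t \<omega>))\<^sup>2 / \<gamma>\<^sup>2 - (norm w)\<^sup>2 - (norm g)\<^sup>2) / 2" by simp
  have "env (x (Suc t) \<omega>) \<le> env (x t \<omega>) + \<eta>0 * (- (w \<bullet> g)) + 1 / (2 * \<gamma>) * (\<eta>0\<^sup>2 * (norm g)\<^sup>2)"
    using env_upper[of "x (Suc t) \<omega>" "x t \<omega>"]
    unfolding run_step(4)[OF \<omega> t] by (simp add: w_def g_def power_mult_distrib)
  moreover have "1 / (2 * \<gamma>) * (\<eta>0\<^sup>2 * (norm g)\<^sup>2) \<le> \<eta>0 / 8 * (norm g)\<^sup>2"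
  proof -
    have "\<eta>0 * \<eta>0 / (2 * \<gamma>) \<le> \<eta>0 / 8"
      using mult_left_mono[OF \<eta>0_small, of \<eta>0] \<eta>0_pos \<gamma>_pos by (simp add: field_simps)
    then have "\<eta>0 * \<eta>0 / (2 * \<gamma>) * (norm g)\<^sup>2 \<le> \<eta>0 / 8 * (norm g)\<^sup>2" by (rule mult_right_mono) simp
    then show ?thesis by (simp add: power2_eq_square)
  qed
  moreover have "\<eta>0 * (- (w \<bullet> g)) = \<eta>0 / (2 * \<gamma>\<^sup>2) * (norm (post_x t \<omega>))\<^sup>2
      - \<eta>0 / 2 * (norm w)\<^sup>2 - \<eta>0 / 2 * (norm g)\<^sup>2"
    unfolding wg by (simp add: right_diff_distrib diff_divide_distrib)
  moreover have "\<eta>0 / 2 * (norm g)\<^sup>2 = 3 / 8 * \<eta>0 * (norm g)\<^sup>2 + \<eta>0 / 8 * (norm g)\<^sup>2" by simp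
  ultimately show ?thesis
    unfolding w_def[symmetric] g_def[symmetric] by linarith
qed

text \<open>Telescoping pathwise, before means are taken, keeps the envelope at the intermediate iterates out of
the integrals: the first value is deterministic and the last one is bounded below.\<close>

lemma env_descent_sum:
  assumes \<omega>: "\<omega> \<in> space P" and "n \<le> T"
  shows "env (x n \<omega>) \<le> env x0 + (\<Sum>t<n. \<eta>0 / (2 * \<gamma>\<^sup>2) * (norm (post_x t \<omega>))\<^sup>2
     - \<eta>0 / 2 * (norm (env_grad (x t \<omega>)))\<^sup>2 - 3 / 8 * \<eta>0 * (norm (G (Suc t) \<omega>))\<^sup>2)"
  using \<open>n \<le> T\<close>
proof (induction n)
  case 0
  then show ?case using run_init[OF \<omega>] by simp
next
  case (Suc n)
  then show ?case using env_descent[OF \<omega>, of n] by simp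
qed

lemma G_square_integrable:
  assumes "t < T" shows "square_integrable P (G (Suc t))"
proof -
  have "square_integrable P (G (Suc t)) = square_integrable P (\<lambda>\<omega>. (1 / \<gamma>) *\<^sub>R (x t \<omega> - x\<phi> (Suc t) \<omega>))"
    by (rule square_integrable_cong) (simp add: run_step(3)[OF _ assms])
  then show ?thesis
    using iterates_square_integrable assms
    by (simp only: square_integrable_scaleR square_integrable_diff Suc_leI less_imp_le)
qed

lemma expected_descent:
  assumes low: "\<And>z. Fstar \<le> env z"
  shows "\<eta>0 / 2 * (\<Sum>t<T. \<integral>\<omega>. (norm (env_grad (x t \<omega>)))\<^sup>2 \<partial>P)
      + 3 / 8 * \<eta>0 * (\<Sum>t<T. \<integral>\<omega>. (norm (G (Suc t) \<omega>))\<^sup>2 \<partial>P)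
    \<le> env x0 - Fstar + \<eta>0 / (2 * \<gamma>\<^sup>2) * (\<Sum>t<T. \<integral>\<omega>. (norm (post_x t \<omega>))\<^sup>2 \<partial>P)"
proof -
  have int[simp, intro]: "integrable P (\<lambda>\<omega>. (norm (post_x t \<omega>))\<^sup>2)"
      "integrable P (\<lambda>\<omega>. (norm (env_grad (x t \<omega>)))\<^sup>2)"
      "integrable P (\<lambda>\<omega>. (norm (G (Suc t) \<omega>))\<^sup>2)" if "t < T" for t
    using that gaps_square_integrable(1) env_grad_x_square_integrable[of t] G_square_integrable
    by (auto intro: norm_sq_integrable)
  have "(\<integral>\<omega>. Fstar - env x0 \<partial>P) \<le> (\<integral>\<omega>. (\<Sum>t<T. \<eta>0 / (2 * \<gamma>\<^sup>2) * (norm (post_x t \<omega>))\<^sup>2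
     - \<eta>0 / 2 * (norm (env_grad (x t \<omega>)))\<^sup>2 - 3 / 8 * \<eta>0 * (norm (G (Suc t) \<omega>))\<^sup>2) \<partial>P)"
  proof (rule integral_mono)
    fix \<omega> assume "\<omega> \<in> space P"
    from env_descent_sum[OF this order_refl] low[of "x T \<omega>"]
    show "Fstar - env x0 \<le> (\<Sum>t<T. \<eta>0 / (2 * \<gamma>\<^sup>2) * (norm (post_x t \<omega>))\<^sup>2
     - \<eta>0 / 2 * (norm (env_grad (x t \<omega>)))\<^sup>2 - 3 / 8 * \<eta>0 * (norm (G (Suc t) \<omega>))\<^sup>2)"
      by linarith
  qed auto
  also have "\<dots> = (\<Sum>t<T. \<eta>0 / (2 * \<gamma>\<^sup>2) * (\<integral>\<omega>. (norm (post_x t \<omega>))\<^sup>2 \<partial>P)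
     - \<eta>0 / 2 * (\<integral>\<omega>. (norm (env_grad (x t \<omega>)))\<^sup>2 \<partial>P) - 3 / 8 * \<eta>0 * (\<integral>\<omega>. (norm (G (Suc t) \<omega>))\<^sup>2 \<partial>P))"
    by (subst Bochner_Integration.integral_sum) (auto intro!: sum.cong)
  finally show ?thesis
    by (simp add: prob_space sum_subtractf sum_distrib_left)
qed

text \<open>The two summands are the costs of the movement of \<open>pr\<close>, at contraction rate \<open>\<eta>1 * \<alpha>\<close>, and of \<open>ys\<close>,
at the rate \<open>\<eta>1 * \<mu>\<close>.  Keeping \<open>\<mu>\<close> apart from \<open>\<alpha>\<close> in the second one is what matches the second bound
on \<open>\<tau>\<close> in \<open>lyapunov_bound\<close>.\<close>

definition drift_coeff :: "real \<Rightarrow> real" where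
  "drift_coeff \<alpha> = \<eta>0\<^sup>2 / (4 * \<gamma>\<^sup>2 * \<alpha>\<^sup>2) * (1 / (\<eta>1 * \<alpha>) + L\<^sup>2 / (\<eta>1 * \<mu> ^ 3))"

lemma drift:
  assumes \<omega>: "\<omega> \<in> space P" and t: "t < T" and \<alpha>: "0 < \<alpha>" "2 * \<alpha> \<le> \<rho>" "\<alpha> \<le> \<mu>" "\<eta>1 * \<alpha> \<le> 1"
  shows "(1 - \<eta>1 * \<rho>) * (norm (pre_x (Suc t) \<omega>))\<^sup>2 + (1 - 2 * \<eta>1 * \<mu>) * (norm (pre_y (Suc t) \<omega>))\<^sup>2
    \<le> (1 - \<eta>1 * \<alpha>) * ((norm (post_x t \<omega>))\<^sup>2 + (norm (post_y t \<omega>))\<^sup>2) + drift_coeff \<alpha> * (norm (G (Suc t) \<omega>))\<^sup>2"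
proof -
  define p p' where "p = pr (x t \<omega>)" and "p' = pr (x (Suc t) \<omega>)"
  define D where "D = \<eta>0 * norm (G (Suc t) \<omega>) / (2 * \<gamma> * \<alpha>)"
  have D0: "D \<ge> 0" using \<eta>0_pos \<gamma>_pos \<alpha> by (simp add: D_def)
  have "norm (p - p') \<le> 1 / (\<gamma> * \<rho>) * norm (x t \<omega> - x (Suc t) \<omega>)"
    unfolding p_def p'_def by (rule pr_lipschitz)
  also have "norm (x t \<omega> - x (Suc t) \<omega>) = \<eta>0 * norm (G (Suc t) \<omega>)"
    unfolding run_step(4)[OF \<omega> t] using \<eta>0_pos by simp
  also have "1 / (\<gamma> * \<rho>) * (\<eta>0 * norm (G (Suc t) \<omega>)) \<le> 1 / (\<gamma> * (2 * \<alpha>)) * (\<eta>0 * norm (G (Suc t) \<omega>))"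
    using \<alpha> \<gamma>_pos \<eta>0_pos by (intro mult_right_mono divide_left_mono mult_left_mono) auto
  finally have dp: "norm (p - p') \<le> D" by (simp add: D_def)
  have dq: "norm (ys p - ys p') \<le> L / \<mu> * D"
    using ys_lipschitz[of p p'] mult_left_mono[OF dp, of "L / \<mu>"] L_nonneg \<mu>_pos by simp
  have X: "pre_x (Suc t) \<omega> = post_x t \<omega> + (p - p')" and Y: "pre_y (Suc t) \<omega> = post_y t \<omega> + (ys p - ys p')"
    by (simp_all add: pre_x_def post_x_def pre_y_def post_y_def p_def p'_def)
  have "(1 - \<eta>1 * \<rho>) * (norm (pre_x (Suc t) \<omega>))\<^sup>2 \<le> (1 - 2 * (\<eta>1 * \<alpha>)) * (norm (pre_x (Suc t) \<omega>))\<^sup>2"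
    using mult_left_mono[OF \<alpha>(2), of \<eta>1] \<eta>1_pos by (intro mult_right_mono) auto
  also have "\<dots> \<le> (1 - \<eta>1 * \<alpha>) * (norm (post_x t \<omega>))\<^sup>2 + (norm (p - p'))\<^sup>2 / (\<eta>1 * \<alpha>)"
    unfolding X using young_contraction[of "\<eta>1 * \<alpha>" "\<eta>1 * \<alpha>"] \<alpha> \<eta>1_pos by simp
  also have "(norm (p - p'))\<^sup>2 / (\<eta>1 * \<alpha>) \<le> D\<^sup>2 / (\<eta>1 * \<alpha>)"
    using dp \<alpha> \<eta>1_pos by (intro divide_right_mono power_mono) auto
  finally have 1: "(1 - \<eta>1 * \<rho>) * (norm (pre_x (Suc t) \<omega>))\<^sup>2 \<le> (1 - \<eta>1 * \<alpha>) * (norm (post_x t \<omega>))\<^sup>2 + D\<^sup>2 / (\<eta>1 * \<alpha>)"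
    by simp
  have "(1 - 2 * \<eta>1 * \<mu>) * (norm (pre_y (Suc t) \<omega>))\<^sup>2
     \<le> (1 - \<eta>1 * \<alpha>) * (norm (post_y t \<omega>))\<^sup>2 + (norm (ys p - ys p'))\<^sup>2 / (\<eta>1 * \<mu>)"
    unfolding Y using young_contraction[of "\<eta>1 * \<mu>" "\<eta>1 * \<alpha>" "post_y t \<omega>" "ys p - ys p'"] \<alpha> \<eta>1_pos \<mu>_pos
    by (simp add: mult.assoc)
  also have "(norm (ys p - ys p'))\<^sup>2 / (\<eta>1 * \<mu>) \<le> (L / \<mu> * D)\<^sup>2 / (\<eta>1 * \<mu>)"
    using dq \<mu>_pos \<eta>1_pos by (intro divide_right_mono power_mono) auto
  finally have 2: "(1 - 2 * \<eta>1 * \<mu>) * (norm (pre_y (Suc t) \<omega>))\<^sup>2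
     \<le> (1 - \<eta>1 * \<alpha>) * (norm (post_y t \<omega>))\<^sup>2 + (L / \<mu> * D)\<^sup>2 / (\<eta>1 * \<mu>)" by simp
  have "D\<^sup>2 / (\<eta>1 * \<alpha>) + (L / \<mu> * D)\<^sup>2 / (\<eta>1 * \<mu>) = D\<^sup>2 * (1 / (\<eta>1 * \<alpha>) + L\<^sup>2 / (\<eta>1 * \<mu> ^ 3))"
    by (simp add: power_mult_distrib power_divide power2_eq_square power3_eq_cube algebra_simps)
  also have "\<dots> = drift_coeff \<alpha> * (norm (G (Suc t) \<omega>))\<^sup>2"
    by (simp add: drift_coeff_def D_def power_divide power_mult_distrib mult_ac)
  finally have "D\<^sup>2 / (\<eta>1 * \<alpha>) + (L / \<mu> * D)\<^sup>2 / (\<eta>1 * \<mu>) = drift_coeff \<alpha> * (norm (G (Suc t) \<omega>))\<^sup>2" .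
  then show ?thesis using 1 2 by (simp add: distrib_left)
qed

lemma gap_recursion:
  assumes t: "Suc t < T" and \<alpha>: "0 < \<alpha>" "2 * \<alpha> \<le> \<rho>" "\<alpha> \<le> \<mu>" "\<eta>1 * \<alpha> \<le> 1"
  shows "\<Delta> (Suc t) \<le> (1 - \<eta>1 * \<alpha>) * \<Delta> t + drift_coeff \<alpha> * (\<integral>\<omega>. (norm (G (Suc t) \<omega>))\<^sup>2 \<partial>P) + 9 * \<eta>1\<^sup>2 * M\<^sup>2"
proof -
  have [simp, intro]: "integrable P (\<lambda>\<omega>. (norm (post_x t \<omega>))\<^sup>2)" "integrable P (\<lambda>\<omega>. (norm (post_y t \<omega>))\<^sup>2)"
      "integrable P (\<lambda>\<omega>. (norm (pre_x (Suc t) \<omega>))\<^sup>2)" "integrable P (\<lambda>\<omega>. (norm (pre_y (Suc t) \<omega>))\<^sup>2)"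
      "integrable P (\<lambda>\<omega>. (norm (G (Suc t) \<omega>))\<^sup>2)"
    using t gaps_square_integrable(1,2)[of t] gaps_square_integrable(3,4)[of "Suc t"] G_square_integrable[of t]
    by (auto intro: norm_sq_integrable)
  have "(\<integral>\<omega>. (1 - \<eta>1 * \<rho>) * (norm (pre_x (Suc t) \<omega>))\<^sup>2 + (1 - 2 * \<eta>1 * \<mu>) * (norm (pre_y (Suc t) \<omega>))\<^sup>2 \<partial>P)
    \<le> (\<integral>\<omega>. (1 - \<eta>1 * \<alpha>) * ((norm (post_x t \<omega>))\<^sup>2 + (norm (post_y t \<omega>))\<^sup>2) + drift_coeff \<alpha> * (norm (G (Suc t) \<omega>))\<^sup>2 \<partial>P)"
    by (rule integral_mono) (use drift[OF _ _ \<alpha>] t in \<open>auto simp: drift_coeff_def\<close>)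
  also have "\<dots> = (1 - \<eta>1 * \<alpha>) * \<Delta> t + drift_coeff \<alpha> * (\<integral>\<omega>. (norm (G (Suc t) \<omega>))\<^sup>2 \<partial>P)"
    by (simp add: \<Delta>_def)
  finally show ?thesis using one_step[OF t] by simp
qed

lemma \<Delta>_nonneg: "\<Delta> t \<ge> 0"
  by (simp add: \<Delta>_def)

text \<open>The recursion \<open>gap_recursion\<close> is available up to \<open>\<Delta> (T - 1)\<close>, the last gap that the run defines.
Summing it leaves \<open>\<Delta> (T - 1)\<close> itself on the left, and this is at least its share \<open>\<eta>1 * \<alpha> * \<Delta> (T - 1)\<close>
of the full sum.\<close>

lemma gap_sum:
  assumes T: "T \<ge> 1" and \<alpha>: "0 < \<alpha>" "2 * \<alpha> \<le> \<rho>" "\<alpha> \<le> \<mu>" "\<eta>1 * \<alpha> \<le> 1"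
  shows "\<eta>1 * \<alpha> * (\<Sum>t<T. \<Delta> t)
    \<le> \<Delta> 0 + drift_coeff \<alpha> * (\<Sum>t<T. \<integral>\<omega>. (norm (G (Suc t) \<omega>))\<^sup>2 \<partial>P) + real T * (9 * \<eta>1\<^sup>2 * M\<^sup>2)"
proof -
  define EG where "EG t = (\<integral>\<omega>. (norm (G (Suc t) \<omega>))\<^sup>2 \<partial>P)" for t
  have EG: "EG t \<ge> 0" for t by (simp add: EG_def)
  have coeff: "drift_coeff \<alpha> \<ge> 0" unfolding drift_coeff_def using \<eta>1_pos \<alpha> \<mu>_pos by simp
  have "\<eta>1 * \<alpha> * (\<Sum>t<n. \<Delta> t) + \<Delta> n \<le> \<Delta> 0 + drift_coeff \<alpha> * (\<Sum>t<n. EG t) + real n * (9 * \<eta>1\<^sup>2 * M\<^sup>2)" if "n < T" for n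
    using that
  proof (induction n)
    case (Suc n)
    then show ?case
      using gap_recursion[OF Suc.prems \<alpha>, folded EG_def] by (simp add: algebra_simps)
  qed simp
  from this[of "T - 1"] T
  have "\<eta>1 * \<alpha> * (\<Sum>t<T - 1. \<Delta> t) + \<Delta> (T - 1)
      \<le> \<Delta> 0 + drift_coeff \<alpha> * (\<Sum>t<T - 1. EG t) + real (T - 1) * (9 * \<eta>1\<^sup>2 * M\<^sup>2)" by simp
  moreover have split: "(\<Sum>t<T. f t) = (\<Sum>t<T - 1. f t) + f (T - 1)" for f :: "nat \<Rightarrow> real"
    using T by (cases T) auto
  moreover have "\<eta>1 * \<alpha> * \<Delta> (T - 1) \<le> \<Delta> (T - 1)"
    using \<alpha>(4) \<Delta>_nonneg mult_left_le_one_le[of "\<Delta> (T - 1)" "\<eta>1 * \<alpha>"] \<alpha>(1) \<eta>1_pos by simp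
  moreover have "drift_coeff \<alpha> * EG (T - 1) \<ge> 0" using coeff EG by simp
  moreover have "real (T - 1) * (9 * \<eta>1\<^sup>2 * M\<^sup>2) \<le> real T * (9 * \<eta>1\<^sup>2 * M\<^sup>2)"
    by (intro mult_right_mono) auto
  ultimately show ?thesis
    unfolding EG_def[symmetric] split by (simp add: distrib_left)
qed

text \<open>The weight \<open>c\<close> satisfies \<open>c * \<eta>1 * \<alpha> = 2 * \<eta>0 / \<gamma>\<^sup>2\<close>, four times the coefficient with which the
error of \<open>x\<phi>\<close> enters the descent of the envelope; so three quarters of it survive.  The
bounds on \<open>\<tau>\<close> say that each summand of \<open>c * drift_coeff \<alpha>\<close> is at most \<open>\<eta>0 / 32\<close>.\<close>

lemma lyapunov_bound:
  assumes T: "T \<ge> 1" and \<alpha>: "0 < \<alpha>" "2 * \<alpha> \<le> \<rho>" "\<alpha> \<le> \<mu>" "\<eta>1 * \<alpha> \<le> 1"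
    and low: "\<And>z. Fstar \<le> env z"
    and \<tau>: "\<eta>0 = \<tau> * \<eta>1" "0 < \<tau>" "\<tau> \<le> \<gamma>\<^sup>2 * \<alpha>\<^sup>2 / 4" "\<tau>\<^sup>2 * L\<^sup>2 \<le> \<mu> ^ 3 * \<gamma> ^ 4 * \<alpha> ^ 3 / 16"
  defines "c \<equiv> 2 * \<tau> / (\<gamma>\<^sup>2 * \<alpha>)"
  shows "\<eta>0 / 2 * (\<Sum>t<T. \<integral>\<omega>. (norm (env_grad (x t \<omega>)))\<^sup>2 \<partial>P)
      + 3 / 2 * (\<eta>0 / \<gamma>\<^sup>2) * (\<Sum>t<T. \<integral>\<omega>. (norm (post_x t \<omega>))\<^sup>2 \<partial>P)
    \<le> env x0 - Fstar + c * \<Delta> 0 + c * (real T * (9 * \<eta>1\<^sup>2 * M\<^sup>2))"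
proof -
  define SG where "SG = (\<Sum>t<T. \<integral>\<omega>. (norm (G (Suc t) \<omega>))\<^sup>2 \<partial>P)"
  define SX where "SX = (\<Sum>t<T. \<integral>\<omega>. (norm (post_x t \<omega>))\<^sup>2 \<partial>P)"
  define SW where "SW = (\<Sum>t<T. \<integral>\<omega>. (norm (env_grad (x t \<omega>)))\<^sup>2 \<partial>P)"
  define u where "u = \<eta>0 / \<gamma>\<^sup>2 * SX"
  have SG: "SG \<ge> 0" unfolding SG_def by (intro sum_nonneg) simp
  have c: "c > 0" unfolding c_def using \<tau> \<gamma>_pos \<alpha> by simp
  have "SX \<le> (\<Sum>t<T. \<Delta> t)" unfolding SX_def \<Delta>_def by (intro sum_mono) simp
  then have "c * (\<eta>1 * \<alpha> * SX) \<le> c * (\<eta>1 * \<alpha> * (\<Sum>t<T. \<Delta> t))"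
    using c \<eta>1_pos \<alpha> by (intro mult_left_mono) auto
  also have "\<dots> \<le> c * (\<Delta> 0 + drift_coeff \<alpha> * SG + real T * (9 * \<eta>1\<^sup>2 * M\<^sup>2))"
    using gap_sum[OF T \<alpha>, folded SG_def] c by (intro mult_left_mono) auto
  finally have "c * (\<eta>1 * \<alpha> * SX) \<le> c * \<Delta> 0 + c * drift_coeff \<alpha> * SG + c * (real T * (9 * \<eta>1\<^sup>2 * M\<^sup>2))"
    by (simp add: algebra_simps)
  moreover have "c * (\<eta>1 * \<alpha> * SX) = 2 * u"
    using \<alpha> by (simp add: c_def \<tau>(1) u_def)
  moreover have "c * drift_coeff \<alpha> * SG \<le> \<eta>0 / 16 * SG"
  proof (rule mult_right_mono[OF _ SG])
    have "\<tau>\<^sup>2 \<le> (\<gamma>\<^sup>2 * \<alpha>\<^sup>2 / 4)\<^sup>2" using \<tau> by (intro power_mono) auto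
    also have "\<dots> = \<gamma> ^ 4 * \<alpha> ^ 4 / 16" by (simp add: power_divide power_mult_distrib flip: power_mult)
    finally have "\<tau>\<^sup>2 / (2 * \<gamma> ^ 4 * \<alpha> ^ 4) \<le> 1 / 32" using \<gamma>_pos \<alpha> by (simp add: field_simps)
    moreover have "\<tau>\<^sup>2 * L\<^sup>2 / (2 * \<gamma> ^ 4 * \<alpha> ^ 3 * \<mu> ^ 3) \<le> 1 / 32"
      using \<tau>(4) \<gamma>_pos \<alpha> \<mu>_pos by (simp add: field_simps)
    ultimately have le: "\<tau>\<^sup>2 / (2 * \<gamma> ^ 4 * \<alpha> ^ 4) + \<tau>\<^sup>2 * L\<^sup>2 / (2 * \<gamma> ^ 4 * \<alpha> ^ 3 * \<mu> ^ 3) \<le> 1 / 16" by simp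
    have "c * drift_coeff \<alpha> = \<eta>0 * (\<tau>\<^sup>2 / (2 * \<gamma> ^ 4 * \<alpha> ^ 4) + \<tau>\<^sup>2 * L\<^sup>2 / (2 * \<gamma> ^ 4 * \<alpha> ^ 3 * \<mu> ^ 3))"
      unfolding drift_coeff_def unfolding c_def \<tau>(1) using \<gamma>_pos \<alpha>(1) \<mu>_pos \<eta>1_pos \<tau>(2)
      by (simp add: field_simps power2_eq_square power3_eq_cube power4_eq_xxxx)
    also have "\<dots> \<le> \<eta>0 * (1 / 16)" using le \<eta>0_pos by (intro mult_left_mono) auto
    finally show "c * drift_coeff \<alpha> \<le> \<eta>0 / 16" by simp
  qed
  moreover have "\<eta>0 / 16 * SG \<le> 3 / 8 * \<eta>0 * SG" using SG \<eta>0_pos by (intro mult_right_mono) auto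
  moreover have "\<eta>0 / 2 * SW + 3 / 8 * \<eta>0 * SG \<le> env x0 - Fstar + 1 / 2 * u"
    using expected_descent[OF low] unfolding SW_def SX_def SG_def u_def by simp
  ultimately have "\<eta>0 / 2 * SW + 2 * u \<le> env x0 - Fstar + c * \<Delta> 0 + c * (real T * (9 * \<eta>1\<^sup>2 * M\<^sup>2)) + 1 / 2 * u"
    by linarith
  moreover have eq: "3 / 2 * (\<eta>0 / \<gamma>\<^sup>2) * SX = 3 / 2 * u" by (simp only: u_def mult.assoc)
  ultimately show ?thesis unfolding SW_def[symmetric] SX_def[symmetric] eq by linarith
qed

text \<open>The bound \<open>b\<close> on the expected norm of the envelope gradient is the square root of the bound on its
mean square; it is at most \<open>\<epsilon> / 2\<close> and at most \<open>\<epsilon> / (2 * \<gamma>)\<close>, and the distance to the proximal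
point is \<open>\<gamma>\<close> times that norm.\<close>

lemma random_iterate_nearly_critical:
  assumes T: "T \<ge> 1" and \<epsilon>: "\<epsilon> > 0"
    and avg: "1 / real T * (\<Sum>t<T. \<integral>\<omega>. (norm (env_grad (x t \<omega>)))\<^sup>2 \<partial>P) \<le> min 1 (1 / \<gamma>\<^sup>2) * (\<epsilon>\<^sup>2 / 4)"
  shows "nearly_critical (P \<Otimes>\<^sub>M uniform_count_measure {..<T}) F (\<lambda>_. 0) \<epsilon> (\<lambda>(\<omega>, t). x t \<omega>)"
proof -
  define N where "N = P \<Otimes>\<^sub>M uniform_count_measure {..<T}"
  define W where "W = (\<lambda>(\<omega>, t). env_grad (x t \<omega>))"
  define b where "b = min 1 (1 / \<gamma>) * (\<epsilon> / 2)"
  have b: "b > 0" using \<epsilon> \<gamma>_pos by (simp add: b_def)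
  have b2: "b\<^sup>2 = min 1 (1 / \<gamma>\<^sup>2) * (\<epsilon>\<^sup>2 / 4)"
  proof -
    have "(min 1 (1 / \<gamma>))\<^sup>2 = min 1 (1 / \<gamma>\<^sup>2)"
    proof (cases "\<gamma> \<le> 1")
      case True
      then have "\<gamma>\<^sup>2 \<le> 1" using \<gamma>_pos by (simp add: power_le_one)
      then show ?thesis using True \<gamma>_pos by (simp add: min_def field_simps)
    next
      case False
      then have "1 / \<gamma> \<le> 1" by simp
      moreover from this have "(1 / \<gamma>)\<^sup>2 \<le> 1" using \<gamma>_pos by (intro power_le_one) auto
      ultimately show ?thesis by (simp add: min_absorb2 power_divide)
    qed
    then show ?thesis by (simp add: b_def power_mult_distrib power_divide)
  qed
  have intW: "integrable P (\<lambda>\<omega>. norm (env_grad (x t \<omega>)))" if "t < T" for t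
    using that by (intro integrable_norm_of_square[OF _ b] env_grad_x_square_integrable) simp
  have xm: "(\<lambda>(\<omega>, t). x t \<omega>) \<in> borel_measurable N"
    unfolding N_def by (rule random_index_measurable) (use iterates_measurable in auto)
  have Wm: "W \<in> borel_measurable N"
    unfolding N_def W_def by (rule random_index_measurable) (use env_grad_x_measurable in auto)
  have pm: "(\<lambda>(\<omega>, t). pr (x t \<omega>)) \<in> borel_measurable N"
    unfolding N_def by (rule random_index_measurable)
      (use pr_x_square_integrable in \<open>auto simp: square_integrable_def\<close>)
  have WN: "integrable N (\<lambda>z. norm (W z))"
    and IW: "(\<integral>z. norm (W z) \<partial>N) = 1 / real T * (\<Sum>t<T. \<integral>\<omega>. norm (env_grad (x t \<omega>)) \<partial>P)"
    using random_index_integral[OF prob_space_axioms T intW]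
    by (simp_all add: N_def W_def case_prod_beta')
  have "(\<Sum>t<T. \<integral>\<omega>. norm (env_grad (x t \<omega>)) \<partial>P)
      \<le> (\<Sum>t<T. ((\<integral>\<omega>. (norm (env_grad (x t \<omega>)))\<^sup>2 \<partial>P) / b + b) / 2)"
    by (intro sum_mono first_moment_le env_grad_x_square_integrable b) simp
  also have "\<dots> = ((\<Sum>t<T. \<integral>\<omega>. (norm (env_grad (x t \<omega>)))\<^sup>2 \<partial>P) / b + real T * b) / 2"
    by (simp add: sum_divide_distrib[symmetric] sum.distrib)
  also have "\<dots> \<le> (real T * b\<^sup>2 / b + real T * b) / 2"
    using avg T b unfolding b2[symmetric]
    by (intro divide_right_mono add_right_mono) (auto simp: field_simps)
  also have "\<dots> = real T * b" using b by (simp add: power2_eq_square)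
  finally have Wb: "(\<integral>z. norm (W z) \<partial>N) \<le> b" unfolding IW using T by (simp add: field_simps)
  have dist: "(case z of (\<omega>, t) \<Rightarrow> x t \<omega>) - (case z of (\<omega>, t) \<Rightarrow> pr (x t \<omega>)) = \<gamma> *\<^sub>R W z" for z
    by (cases z) (simp add: W_def pr_env_grad)
  have "b \<le> \<epsilon>" using \<epsilon> mult_right_mono[of "min 1 (1 / \<gamma>)" 1 "\<epsilon> / 2"] by (simp add: b_def)
  moreover have "\<gamma> * b \<le> \<epsilon>"
  proof -
    have "\<gamma> * b \<le> \<gamma> * ((1 / \<gamma>) * (\<epsilon> / 2))"
      unfolding b_def using \<gamma>_pos \<epsilon> by (intro mult_left_mono mult_right_mono) auto
    then show ?thesis using \<gamma>_pos \<epsilon> by simp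
  qed
  moreover have "\<gamma> * (\<integral>z. norm (W z) \<partial>N) \<le> \<gamma> * b" using Wb \<gamma>_pos by (intro mult_left_mono) auto
  ultimately have "(\<integral>z. norm (W z) \<partial>N) \<le> \<epsilon>" "\<gamma> * (\<integral>z. norm (W z) \<partial>N) \<le> \<epsilon>"
    using Wb by linarith+
  then have Max: "Max {\<integral>z. norm (W z) \<partial>N, \<integral>z. norm (\<gamma> *\<^sub>R W z) \<partial>N,
      \<integral>z. norm ((case z of (\<omega>, t) \<Rightarrow> x t \<omega>) - (case z of (\<omega>, t) \<Rightarrow> x t \<omega>)) \<partial>N} \<le> \<epsilon>"
    using \<epsilon> \<gamma>_pos by simp
  have zero: "0 \<in> subdifferential (\<lambda>_. 0::real) u" for u :: 'a
    unfolding subdifferential_def by (auto intro!: bexI[of _ "\<lambda>_. 0"])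
  show ?thesis
    unfolding nearly_critical_def N_def[symmetric]
  proof (rule conjI, rule xm, rule exI[of _ W], rule exI[of _ "\<lambda>(\<omega>, t). pr (x t \<omega>)"],
      rule exI[of _ "\<lambda>(\<omega>, t). x t \<omega>"], intro conjI)
    show "\<forall>z\<in>space N. W z \<in> {a - b |a b. a \<in> subdifferential F (case z of (\<omega>, t) \<Rightarrow> pr (x t \<omega>)) \<and>
        b \<in> subdifferential (\<lambda>_. 0) (case z of (\<omega>, t) \<Rightarrow> x t \<omega>)}"
    proof
      fix z assume "z \<in> space N"
      obtain \<omega> t where z: "z = (\<omega>, t)" by (cases z)
      show "W z \<in> {a - b |a b. a \<in> subdifferential F (case z of (\<omega>, t) \<Rightarrow> pr (x t \<omega>)) \<and>
        b \<in> subdifferential (\<lambda>_. 0) (case z of (\<omega>, t) \<Rightarrow> x t \<omega>)}"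
        using env_grad_in_subdifferential[of "x t \<omega>"] zero[of "x t \<omega>"]
        by (force simp: z W_def)
    qed
    show "integrable N (\<lambda>z. norm ((case z of (\<omega>, t) \<Rightarrow> x t \<omega>) - (case z of (\<omega>, t) \<Rightarrow> pr (x t \<omega>))))"
      unfolding dist using WN by simp
    show "Max {\<integral>z. norm (W z) \<partial>N,
        \<integral>z. norm ((case z of (\<omega>, t) \<Rightarrow> x t \<omega>) - (case z of (\<omega>, t) \<Rightarrow> pr (x t \<omega>))) \<partial>N,
        \<integral>z. norm ((case z of (\<omega>, t) \<Rightarrow> x t \<omega>) - (case z of (\<omega>, t) \<Rightarrow> x t \<omega>)) \<partial>N} \<le> \<epsilon>"
      unfolding dist by (rule Max)
  qed (use Wm pm xm WN in simp_all)
qed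

end

section \<open>Accuracy under the choice of the parameters\<close>

text \<open>With \<open>m = min 1 (1 / \<gamma>\<^sup>2)\<close> and \<open>\<kappa> = \<nu> * min \<alpha> \<tau> / \<tau>\<close>, the choice of \<open>T\<close> bounds the contribution of
\<open>A\<close> by \<open>T * m * \<kappa> * \<epsilon>\<^sup>2 / 16\<close>, and the choice of \<open>\<eta>1\<close> bounds the noise by \<open>3 / 64\<close> of the same
quantity.  Together this is \<open>7 / 64\<close>, and it remains to see that \<open>\<kappa>\<close> is at most of the order of \<open>m\<close>.
For \<open>\<gamma> \<le> 4\<close> one has \<open>\<kappa> \<le> m\<close>.  For \<open>\<gamma> > 4\<close> only \<open>\<kappa> \<le> 2 * m\<close> holds, but then the coefficients of
both sums on the left are at least \<open>3 / 2 * m\<close> instead of \<open>m / 2\<close>.\<close>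

lemma average_le_accuracy:
  fixes \<alpha> \<gamma> \<tau> \<nu> \<eta>1 M \<epsilon> A S1 SX T :: real
  assumes pos: "\<alpha> > 0" "\<gamma> > 0" "\<tau> > 0" "\<eta>1 > 0" "M > 0" "\<epsilon> > 0" "T > 0"
    and \<alpha>: "\<gamma> * \<alpha> \<le> 1 / 2" and \<tau>: "\<tau> \<le> \<gamma>\<^sup>2 * \<alpha>\<^sup>2 / 4"
    and \<nu>: "\<nu> = min 1 (2 * \<tau> / (\<gamma>\<^sup>2 * \<alpha>))"
    and \<eta>1: "\<eta>1 \<le> min 1 (\<gamma>\<^sup>2) * min \<alpha> \<tau> * \<nu> * \<alpha> / (384 * \<tau> * M\<^sup>2) * \<epsilon>\<^sup>2"
    and T: "16 * A / (min 1 (1 / \<gamma>\<^sup>2) * min \<alpha> \<tau> * \<nu> * \<epsilon>\<^sup>2) * (1 / \<eta>1) \<le> T"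
    and S: "S1 \<ge> 0" "SX \<ge> 0"
    and bound: "\<tau> * \<eta>1 / 2 * S1 + 3 / 2 * (\<tau> * \<eta>1 / \<gamma>\<^sup>2) * SX
       \<le> A + 2 * \<tau> / (\<gamma>\<^sup>2 * \<alpha>) * (T * (9 * \<eta>1\<^sup>2 * M\<^sup>2))"
  shows "1 / T * (SX + S1) \<le> min 1 (1 / \<gamma>\<^sup>2) * (\<epsilon>\<^sup>2 / 4)"
proof -
  define m where "m = min 1 (1 / \<gamma>\<^sup>2)"
  define \<kappa> where "\<kappa> = \<nu> * min \<alpha> \<tau> / \<tau>"
  have m: "m > 0" using pos by (simp add: m_def)
  have \<nu>0: "\<nu> > 0" using pos by (simp add: \<nu>)
  have \<kappa>: "\<kappa> > 0" using pos \<nu>0 by (simp add: \<kappa>_def)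
  have mg: "min 1 (\<gamma>\<^sup>2) = m * \<gamma>\<^sup>2" using pos by (simp add: m_def min_mult_distrib_right)
  have \<kappa>eq: "min \<alpha> \<tau> * \<nu> = \<kappa> * \<tau>" using pos by (simp add: \<kappa>_def)
  have "16 * A \<le> T * (m * (\<kappa> * \<tau>) * \<epsilon>\<^sup>2 * \<eta>1)"
  proof -
    have eq: "min 1 (1 / \<gamma>\<^sup>2) * min \<alpha> \<tau> * \<nu> * \<epsilon>\<^sup>2 = m * (\<kappa> * \<tau>) * \<epsilon>\<^sup>2"
      by (simp add: m_def \<kappa>eq[symmetric])
    have "16 * A / (m * (\<kappa> * \<tau>) * \<epsilon>\<^sup>2 * \<eta>1) \<le> T" using T unfolding eq by simp
    moreover have "m * (\<kappa> * \<tau>) * \<epsilon>\<^sup>2 * \<eta>1 > 0" using m \<kappa> pos by simp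
    ultimately show ?thesis by (simp add: pos_divide_le_eq)
  qed
  then have hA: "A \<le> \<tau> * \<eta>1 * (T * m * \<kappa> * \<epsilon>\<^sup>2 / 16)" by (simp add: mult_ac)
  have "\<eta>1 \<le> m * \<gamma>\<^sup>2 * \<kappa> * \<alpha> * \<epsilon>\<^sup>2 / (384 * M\<^sup>2)"
  proof -
    have "min 1 (\<gamma>\<^sup>2) * min \<alpha> \<tau> * \<nu> * \<alpha> / (384 * \<tau> * M\<^sup>2) * \<epsilon>\<^sup>2
       = (m * \<gamma>\<^sup>2) * (\<kappa> * \<tau>) * \<alpha> / (384 * \<tau> * M\<^sup>2) * \<epsilon>\<^sup>2"
      unfolding mg \<kappa>eq[symmetric] by simp
    also have "\<dots> = m * \<gamma>\<^sup>2 * \<kappa> * \<alpha> * \<epsilon>\<^sup>2 / (384 * M\<^sup>2)" using pos by (simp add: field_simps)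
    finally show ?thesis using \<eta>1 by simp
  qed
  then have e: "\<eta>1 * (384 * M\<^sup>2) \<le> m * \<gamma>\<^sup>2 * \<kappa> * \<alpha> * \<epsilon>\<^sup>2" using pos by (simp add: pos_le_divide_eq)
  have "18 * \<eta>1 * M\<^sup>2 / (\<gamma>\<^sup>2 * \<alpha>) \<le> 3 / 64 * (m * \<kappa> * \<epsilon>\<^sup>2)"
    using e pos by (simp add: field_simps)
  then have "\<tau> * \<eta>1 * T * (18 * \<eta>1 * M\<^sup>2 / (\<gamma>\<^sup>2 * \<alpha>)) \<le> \<tau> * \<eta>1 * T * (3 / 64 * (m * \<kappa> * \<epsilon>\<^sup>2))"
    using pos by (intro mult_left_mono) auto
  then have hN: "2 * \<tau> / (\<gamma>\<^sup>2 * \<alpha>) * (T * (9 * \<eta>1\<^sup>2 * M\<^sup>2)) \<le> \<tau> * \<eta>1 * (T * (3 / 64 * (m * \<kappa> * \<epsilon>\<^sup>2)))"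
    by (simp add: power2_eq_square mult_ac)
  have "\<tau> * \<eta>1 * (S1 / 2 + 3 / 2 * (SX / \<gamma>\<^sup>2)) \<le> \<tau> * \<eta>1 * (7 / 64 * (T * m * \<kappa> * \<epsilon>\<^sup>2))"
  proof -
    have "\<tau> * \<eta>1 * (S1 / 2 + 3 / 2 * (SX / \<gamma>\<^sup>2)) = \<tau> * \<eta>1 / 2 * S1 + 3 / 2 * (\<tau> * \<eta>1 / \<gamma>\<^sup>2) * SX"
      by (simp add: algebra_simps)
    also have "\<dots> \<le> \<tau> * \<eta>1 * (T * m * \<kappa> * \<epsilon>\<^sup>2 / 16) + \<tau> * \<eta>1 * (T * (3 / 64 * (m * \<kappa> * \<epsilon>\<^sup>2)))"
      using bound hA hN by linarith
    also have "\<dots> = \<tau> * \<eta>1 * (7 / 64 * (T * m * \<kappa> * \<epsilon>\<^sup>2))" by (simp add: algebra_simps)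
    finally show ?thesis .
  qed
  then have main: "S1 / 2 + 3 / 2 * (SX / \<gamma>\<^sup>2) \<le> 7 / 64 * (T * m * \<kappa> * \<epsilon>\<^sup>2)"
    using pos by simp
  have \<kappa>1: "\<kappa> \<le> \<nu>"
  proof -
    have "\<nu> * min \<alpha> \<tau> \<le> \<nu> * \<tau>" using \<nu>0 by (intro mult_left_mono) auto
    then show ?thesis unfolding \<kappa>_def using pos by (simp add: divide_le_eq)
  qed
  have mSX: "m * SX \<le> SX / \<gamma>\<^sup>2"
    using mult_right_mono[of m "1 / \<gamma>\<^sup>2" SX] S by (simp add: m_def)
  have "SX + S1 \<le> T * (m * (\<epsilon>\<^sup>2 / 4))"
  proof (cases "\<gamma> \<le> 4")
    case True
    have "\<kappa> \<le> m"
    proof -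
      have "2 * \<tau> / (\<gamma>\<^sup>2 * \<alpha>) \<le> \<alpha> / 2" using \<tau> pos by (simp add: field_simps power2_eq_square)
      also have "\<dots> \<le> 1 / \<gamma>\<^sup>2"
      proof -
        have "\<gamma> * (\<gamma> * \<alpha>) \<le> 4 * (1 / 2)" using True \<alpha> pos by (intro mult_mono) auto
        then show ?thesis using pos by (simp add: field_simps power2_eq_square)
      qed
      finally have "\<nu> \<le> m" by (auto simp: \<nu> m_def)
      then show ?thesis using \<kappa>1 by simp
    qed
    then have "T * m * \<kappa> * \<epsilon>\<^sup>2 \<le> T * m * m * \<epsilon>\<^sup>2"
      using m pos by (intro mult_left_mono mult_right_mono) auto
    moreover have "m * (SX + S1) \<le> S1 + 3 * (SX / \<gamma>\<^sup>2)"
    proof -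
      have "m * S1 \<le> 1 * S1" using S by (intro mult_right_mono) (auto simp: m_def)
      moreover have "SX / \<gamma>\<^sup>2 \<ge> 0" using S by simp
      ultimately show ?thesis using mSX by (simp add: distrib_left)
    qed
    ultimately have "m * (SX + S1) \<le> 7 / 32 * (T * m * m * \<epsilon>\<^sup>2)"
      using main by linarith
    also have "\<dots> = m * (7 / 32 * (T * m * \<epsilon>\<^sup>2))" by simp
    finally have "SX + S1 \<le> 7 / 32 * (T * m * \<epsilon>\<^sup>2)" using m by simp
    also have "\<dots> \<le> 8 / 32 * (T * m * \<epsilon>\<^sup>2)" using pos m by (intro mult_right_mono) auto
    finally show ?thesis by (simp add: mult_ac)
  next
    case False
    then have g: "\<gamma>\<^sup>2 \<ge> 16" using power_mono[of 4 \<gamma> 2] by simp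
    then have "1 / \<gamma>\<^sup>2 \<le> 1" by (intro divide_le_eq_1_pos[THEN iffD2]) auto
    then have mm: "m = 1 / \<gamma>\<^sup>2" by (simp add: m_def min_absorb2)
    have "\<kappa> \<le> 2 * m"
    proof -
      have "\<nu> * min \<alpha> \<tau> \<le> 2 * \<tau> / (\<gamma>\<^sup>2 * \<alpha>) * \<alpha>"
        using pos \<nu>0 by (intro mult_mono) (auto simp: \<nu>)
      also have "\<dots> = 2 * m * \<tau>" using pos by (simp add: mm)
      finally show ?thesis unfolding \<kappa>_def using pos by (simp add: divide_le_eq)
    qed
    then have "T * m * \<kappa> * \<epsilon>\<^sup>2 \<le> T * m * (2 * m) * \<epsilon>\<^sup>2"
      using m pos by (intro mult_left_mono mult_right_mono) auto
    also have "\<dots> = 2 * (T * m * m * \<epsilon>\<^sup>2)" by simp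
    finally have "T * m * \<kappa> * \<epsilon>\<^sup>2 \<le> 2 * (T * m * m * \<epsilon>\<^sup>2)" .
    moreover have "3 / 2 * (m * (SX + S1)) \<le> S1 / 2 + 3 / 2 * (SX / \<gamma>\<^sup>2)"
    proof -
      have "m \<le> 1 / 16" unfolding mm using g by (intro divide_left_mono) auto
      then have "m * S1 \<le> 1 / 16 * S1" using S by (intro mult_right_mono) auto
      then show ?thesis using mSX S by (simp add: distrib_left)
    qed
    ultimately have "m * (SX + S1) \<le> 7 / 48 * (T * m * m * \<epsilon>\<^sup>2)"
      using main by linarith
    also have "\<dots> = m * (7 / 48 * (T * m * \<epsilon>\<^sup>2))" by simp
    finally have "SX + S1 \<le> 7 / 48 * (T * m * \<epsilon>\<^sup>2)" using m by simp
    also have "\<dots> \<le> 12 / 48 * (T * m * \<epsilon>\<^sup>2)" using pos m by (intro mult_right_mono) auto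
    finally show ?thesis by (simp add: mult_ac)
  qed
  then show ?thesis using pos by (simp add: m_def[symmetric] field_simps)
qed

lemma Max_reciprocals_ge:
  fixes a b c :: real
  assumes "e = Min {a, b, c}"
  shows "Max {1 / a, 1 / b, 1 / c} \<ge> 1 / e"
proof -
  have "e \<in> {a, b, c}" unfolding assms by (rule Min_in) auto
  then show ?thesis by (intro Max_ge) auto
qed

theorem corollaryA4:
  fixes Y :: "'b::euclidean_space set"
    and \<phi> :: "'a::euclidean_space \<Rightarrow> 'b \<Rightarrow> real"
    and D :: "'s measure" and \<phi>s :: "'a \<Rightarrow> 'b \<Rightarrow> 's \<Rightarrow> real"
    and grad_y :: "'a \<Rightarrow> 'b \<Rightarrow> 'b"
    and P :: "'w measure"
    and gx :: "nat \<Rightarrow> 'a \<Rightarrow> 'b \<Rightarrow> 'w \<Rightarrow> 'a" and gy :: "nat \<Rightarrow> 'a \<Rightarrow> 'b \<Rightarrow> 'w \<Rightarrow> 'b"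
    and x\<phi> x G :: "nat \<Rightarrow> 'w \<Rightarrow> 'a" and y :: "nat \<Rightarrow> 'w \<Rightarrow> 'b"
    and x\<phi>0 x0 :: 'a and y0 y0_star :: 'b
    and \<delta>\<phi> \<mu>\<phi> L M Fstar \<gamma> \<eta>0 \<eta>1 \<alpha> \<tau> \<nu> L_F P0 \<epsilon> :: real
    and T :: nat
    and F :: "'a \<Rightarrow> real"
  assumes "convex Y" and "compact Y"
    and "prob_space D"
    and "\<forall>x. \<forall>y\<in>Y. integrable D (\<phi>s x y) \<and> \<phi> x y = (\<integral>\<xi>. \<phi>s x y \<xi> \<partial>D)"
    and F_def: "F = max_fun Y \<phi>"
    \<comment> \<open>(i)\<close>
    and "\<delta>\<phi> > 0" and "\<forall>y\<in>Y. weakly_convex \<delta>\<phi> (\<lambda>x. \<phi> x y)"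
    and "\<mu>\<phi> > 0" and "\<forall>x. strongly_concave_on \<mu>\<phi> Y (\<phi> x)"
    \<comment> \<open>(ii)\<close>
    and "\<forall>x. \<forall>y\<in>Y. (\<phi> x has_derivative (\<lambda>h. grad_y x y \<bullet> h)) (at y within Y)"
    and "L > 0" and "\<forall>y\<in>Y. L-lipschitz_on UNIV (\<lambda>x. grad_y x y)"
    \<comment> \<open>(iii)\<close>
    and "\<forall>x. Fstar \<le> moreau_env \<gamma> F x"
    \<comment> \<open>(iv)\<close>
    and "prob_space P" and "M > 0"
    and "\<forall>t<T. \<forall>x. \<forall>y\<in>Y. estimator_of P M (gx t x y) (subdifferential (\<lambda>x. \<phi> x y) x)"
    and "\<forall>t<T. \<forall>x. \<forall>y\<in>Y. estimator_of P M (gy t x y) {grad_y x y}"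
    \<comment> \<open>the algorithm, with (iv) holding conditionally on the past iterates\<close>
    and "y0 \<in> Y"
    and "smag_run P Y gx gy \<gamma> \<eta>0 \<eta>1 T x\<phi>0 x0 y0 x\<phi> x y G"
    and "\<forall>t<T. cond_estimator_of P (history P (\<lambda>s \<omega>. (x\<phi> s \<omega>, x s \<omega>, y s \<omega>)) t) M
                 (\<lambda>\<omega>. gx t (x\<phi> t \<omega>) (y t \<omega>) \<omega>)
                 (\<lambda>\<omega>. subdifferential (\<lambda>x. \<phi> x (y t \<omega>)) (x\<phi> t \<omega>))"
    and "\<forall>t<T. cond_estimator_of P (history P (\<lambda>s \<omega>. (x\<phi> s \<omega>, x s \<omega>, y s \<omega>)) t) M
                 (\<lambda>\<omega>. gy t (x\<phi> t \<omega>) (y t \<omega>) \<omega>)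
                 (\<lambda>\<omega>. {grad_y (x\<phi> t \<omega>) (y t \<omega>)})"
    \<comment> \<open>choice of the parameters\<close>
    and "\<epsilon> > 0"
    and "0 < \<gamma>" and "\<gamma> < 1 / \<delta>\<phi>"
    and "\<alpha> = min ((1 / \<gamma> - \<delta>\<phi>) / 2) \<mu>\<phi>"
    and "\<tau> = min (\<gamma>\<^sup>2 * \<alpha>\<^sup>2 / 4) (\<mu>\<phi> powr (3/2) * \<gamma>\<^sup>2 * \<alpha> powr (3/2) / (4 * L))"
    and "\<nu> = min 1 (2 * \<tau> / (\<gamma>\<^sup>2 * \<alpha>))"
    and "L_F = 2 / \<gamma>"
    and "\<eta>1 = Min {\<gamma>\<^sup>2 * (1 / \<gamma> - \<delta>\<phi>) / 2,
                   1 / (2 * L_F * \<tau>),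
                   min 1 (\<gamma>\<^sup>2) * min \<alpha> \<tau> * \<nu> * \<alpha> / (384 * \<tau> * M\<^sup>2) * \<epsilon>\<^sup>2}"
    and "\<eta>0 = \<tau> * \<eta>1"
    and "y0_star = y_star Y \<phi> (prox \<gamma> F x0)"
    and "P0 = 2 * \<eta>0 / (\<eta>1 * \<gamma>\<^sup>2 * \<alpha>) *
               ((\<integral>\<omega>. (norm (x\<phi> 1 \<omega> - prox \<gamma> F x0))\<^sup>2 \<partial>P) + (\<integral>\<omega>. (norm (y 1 \<omega> - y0_star))\<^sup>2 \<partial>P))"
    and "T \<ge> 1"
    and "real T \<ge> 16 * (moreau_env \<gamma> F x0 - Fstar + P0) / (min 1 (1 / \<gamma>\<^sup>2) * min \<alpha> \<tau> * \<nu> * \<epsilon>\<^sup>2)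
                  * Max {2 / (\<gamma>\<^sup>2 * (1 / \<gamma> - \<delta>\<phi>)),
                         2 * L_F * \<tau>,
                         384 * \<tau> * M\<^sup>2 / (min 1 (\<gamma>\<^sup>2) * min \<alpha> \<tau> * \<nu> * \<alpha> * \<epsilon>\<^sup>2)}"
  shows "(\<forall>t<T. integrable P (\<lambda>\<omega>. (norm (x\<phi> (Suc t) \<omega> - prox \<gamma> F (x t \<omega>)))\<^sup>2)
              \<and> integrable P (\<lambda>\<omega>. (norm (gradient (moreau_env \<gamma> F) (x t \<omega>)))\<^sup>2))
       \<and> 1 / real T * (\<Sum>t<T. (\<integral>\<omega>. (norm (x\<phi> (Suc t) \<omega> - prox \<gamma> F (x t \<omega>)))\<^sup>2 \<partial>P)
                           + (\<integral>\<omega>. (norm (gradient (moreau_env \<gamma> F) (x t \<omega>)))\<^sup>2 \<partial>P))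
           \<le> min 1 (1 / \<gamma>\<^sup>2) * (\<epsilon>\<^sup>2 / 4)
       \<and> nearly_critical (P \<Otimes>\<^sub>M uniform_count_measure {..<T}) F (\<lambda>_. 0) \<epsilon> (\<lambda>(\<omega>, t). x t \<omega>)"
proof -
  define r where "r = 1 / \<gamma> - \<delta>\<phi>"
  have T1: "T \<ge> 1" and T0: "0 < T" using \<open>T \<ge> 1\<close> by auto
  have r: "r > 0" using \<open>0 < \<gamma>\<close> \<open>\<gamma> < 1 / \<delta>\<phi>\<close> \<open>\<delta>\<phi> > 0\<close> by (simp add: r_def field_simps)
  have \<alpha>: "\<alpha> > 0" "2 * \<alpha> \<le> r" "\<alpha> \<le> \<mu>\<phi>"
    using r \<open>\<mu>\<phi> > 0\<close> unfolding \<open>\<alpha> = _\<close> r_def by (auto simp: min_def)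
  have r1: "r * \<gamma> \<le> 1" using \<open>0 < \<gamma>\<close> \<open>\<delta>\<phi> > 0\<close> by (simp add: r_def field_simps)
  have \<gamma>\<alpha>: "\<gamma> * \<alpha> \<le> 1 / 2"
  proof -
    have "\<gamma> * (2 * \<alpha>) \<le> \<gamma> * r" using \<alpha>(2) \<open>0 < \<gamma>\<close> by (intro mult_left_mono) auto
    also have "\<dots> \<le> 1" using r1 by (simp add: mult.commute)
    finally show ?thesis by linarith
  qed
  have \<tau>0: "\<tau> > 0" unfolding \<open>\<tau> = _\<close> using \<alpha> \<open>0 < \<gamma>\<close> \<open>\<mu>\<phi> > 0\<close> \<open>L > 0\<close> by simp
  have \<tau>1: "\<tau> \<le> \<gamma>\<^sup>2 * \<alpha>\<^sup>2 / 4" unfolding \<open>\<tau> = _\<close> by simp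
  have \<tau>2: "\<tau>\<^sup>2 * L\<^sup>2 \<le> \<mu>\<phi> ^ 3 * \<gamma> ^ 4 * \<alpha> ^ 3 / 16"
  proof -
    \<comment> \<open>Squaring the second bound on \<open>\<tau>\<close> turns the fractional powers into cubes.\<close>
    have cube: "(z powr (3/2))\<^sup>2 = z ^ 3" if "z > 0" for z :: real
      using that by (simp add: powr_power)
    have "\<tau>\<^sup>2 \<le> (\<mu>\<phi> powr (3/2) * \<gamma>\<^sup>2 * \<alpha> powr (3/2) / (4 * L))\<^sup>2"
      using \<tau>0 by (intro power_mono) (auto simp: \<open>\<tau> = _\<close>)
    also have "\<dots> = \<mu>\<phi> ^ 3 * \<gamma> ^ 4 * \<alpha> ^ 3 / (16 * L\<^sup>2)"
      using cube[OF \<open>\<mu>\<phi> > 0\<close>] cube[OF \<alpha>(1)] by (simp add: power_divide power_mult_distrib)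
    finally show ?thesis using \<open>L > 0\<close> by (simp add: field_simps)
  qed
  have \<nu>0: "\<nu> > 0" unfolding \<open>\<nu> = _\<close> using \<tau>0 \<alpha> \<open>0 < \<gamma>\<close> by simp
  have LF: "L_F > 0" using \<open>L_F = _\<close> \<open>0 < \<gamma>\<close> by simp
  have \<eta>1_le: "\<eta>1 \<le> \<gamma>\<^sup>2 * (1 / \<gamma> - \<delta>\<phi>) / 2" "\<eta>1 \<le> 1 / (2 * L_F * \<tau>)"
    "\<eta>1 \<le> min 1 (\<gamma>\<^sup>2) * min \<alpha> \<tau> * \<nu> * \<alpha> / (384 * \<tau> * M\<^sup>2) * \<epsilon>\<^sup>2"
    unfolding \<open>\<eta>1 = _\<close> by (rule Min_le; simp)+
  have \<eta>1_pos: "\<eta>1 > 0"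
    unfolding \<open>\<eta>1 = _\<close> using r \<alpha> \<tau>0 \<nu>0 LF \<open>0 < \<gamma>\<close> \<open>M > 0\<close> \<open>\<epsilon> > 0\<close> by (simp add: r_def)
  have \<eta>0_pos: "\<eta>0 > 0" using \<open>\<eta>0 = _\<close> \<tau>0 \<eta>1_pos by simp
  have \<eta>0_le: "\<eta>0 \<le> \<gamma> / 4"
    using \<eta>1_le(2) \<tau>0 \<open>0 < \<gamma>\<close> by (simp add: \<open>\<eta>0 = _\<close> \<open>L_F = _\<close> field_simps)
  have \<eta>1\<alpha>: "\<eta>1 * \<alpha> \<le> 1"
  proof -
    have "\<eta>1 * \<alpha> \<le> (\<gamma>\<^sup>2 * r / 2) * \<alpha>" using \<eta>1_le(1) \<alpha>(1) by (intro mult_right_mono) (auto simp: r_def)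
    also have "\<dots> = (r * \<gamma>) * (\<gamma> * \<alpha>) / 2" by (simp add: power2_eq_square)
    also have "\<dots> \<le> 1 * 1 / 2"
      using r1 \<gamma>\<alpha> \<open>0 < \<gamma>\<close> \<alpha>(1) r by (intro divide_right_mono mult_mono) auto
    finally show ?thesis by simp
  qed
  \<comment> \<open>The estimators of iteration \<open>0\<close> provide a subgradient of norm at most \<open>M\<close> at every point.\<close>
  have gx_est: "estimator_of P M (gx 0 u z) (subdifferential (\<lambda>x. \<phi> x z) u)" if "z \<in> Y" for u z
    using assms(16) T0 that by blast
  interpret smag_iteration Y \<phi> grad_y \<delta>\<phi> \<mu>\<phi> L M \<gamma> P gx gy x\<phi> x G y x\<phi>0 x0 y0 \<eta>0 \<eta>1 T
  proof (intro smag_iteration.intro wcsc_proximal.intro wcsc_problem.intro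
      wcsc_proximal_axioms.intro smag_iteration_axioms.intro \<open>prob_space P\<close>)
    show "\<exists>v\<in>subdifferential (\<lambda>x. \<phi> x z) u. norm v \<le> M" if "z \<in> Y" for u z
      by (rule estimator_mean_bounded[OF \<open>prob_space P\<close> gx_est[OF that] \<open>M > 0\<close>])
    show "Y \<noteq> {}" using \<open>y0 \<in> Y\<close> by auto
  qed (use assms \<eta>0_pos \<eta>1_pos \<eta>1_le(1) \<eta>0_le in blast)+
  define c where "c = 2 * \<tau> / (\<gamma>\<^sup>2 * \<alpha>)"
  have low: "Fstar \<le> env z" for z
    using \<open>\<forall>x. Fstar \<le> moreau_env \<gamma> F x\<close> unfolding F_def by blast
  have "(\<integral>\<omega>. (norm (post_x 0 \<omega>))\<^sup>2 \<partial>P) = (\<integral>\<omega>. (norm (x\<phi> 1 \<omega> - pr x0))\<^sup>2 \<partial>P)"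
    "(\<integral>\<omega>. (norm (post_y 0 \<omega>))\<^sup>2 \<partial>P) = (\<integral>\<omega>. (norm (y 1 \<omega> - ys (pr x0)))\<^sup>2 \<partial>P)"
    by (rule Bochner_Integration.integral_cong[OF refl]; simp add: post_x_def post_y_def run_init)+
  then have P0: "P0 = c * \<Delta> 0"
    using \<eta>1_pos unfolding \<open>P0 = _\<close> \<open>y0_star = _\<close> F_def \<Delta>_def c_def \<open>\<eta>0 = _\<close> by simp
  have c: "c > 0" using \<tau>0 \<alpha> \<open>0 < \<gamma>\<close> by (simp add: c_def)
  define A where "A = env x0 - Fstar + P0"
  have A: "A \<ge> 0" using low[of x0] c \<Delta>_nonneg[of 0] by (simp add: A_def P0)
  define S1 where "S1 = (\<Sum>t<T. \<integral>\<omega>. (norm (env_grad (x t \<omega>)))\<^sup>2 \<partial>P)"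
  define SX where "SX = (\<Sum>t<T. \<integral>\<omega>. (norm (post_x t \<omega>))\<^sup>2 \<partial>P)"
  have S: "S1 \<ge> 0" "SX \<ge> 0" unfolding S1_def SX_def by (auto intro: sum_nonneg)
  have bound: "\<tau> * \<eta>1 / 2 * S1 + 3 / 2 * (\<tau> * \<eta>1 / \<gamma>\<^sup>2) * SX \<le> A + c * (real T * (9 * \<eta>1\<^sup>2 * M\<^sup>2))"
    using lyapunov_bound[OF T1 \<alpha>(1) _ \<alpha>(3) \<eta>1\<alpha> low \<open>\<eta>0 = _\<close> \<tau>0 \<tau>1 \<tau>2] \<alpha>(2)
    unfolding S1_def SX_def A_def P0 c_def \<rho>_def r_def \<open>\<eta>0 = _\<close> by simp
  \<comment> \<open>The maximum ranges over the reciprocals of the three bounds that define \<open>\<eta>1\<close>.\<close>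
  have "1 / \<eta>1 \<le> Max {2 / (\<gamma>\<^sup>2 * (1 / \<gamma> - \<delta>\<phi>)), 2 * L_F * \<tau>,
      384 * \<tau> * M\<^sup>2 / (min 1 (\<gamma>\<^sup>2) * min \<alpha> \<tau> * \<nu> * \<alpha> * \<epsilon>\<^sup>2)}"
    using Max_reciprocals_ge[OF \<open>\<eta>1 = _\<close>] by simp
  moreover have "16 * A / (min 1 (1 / \<gamma>\<^sup>2) * min \<alpha> \<tau> * \<nu> * \<epsilon>\<^sup>2) \<ge> 0"
    using A \<alpha> \<tau>0 \<nu>0 \<open>0 < \<gamma>\<close> by simp
  ultimately have "16 * A / (min 1 (1 / \<gamma>\<^sup>2) * min \<alpha> \<tau> * \<nu> * \<epsilon>\<^sup>2) * (1 / \<eta>1)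
      \<le> 16 * A / (min 1 (1 / \<gamma>\<^sup>2) * min \<alpha> \<tau> * \<nu> * \<epsilon>\<^sup>2)
        * Max {2 / (\<gamma>\<^sup>2 * (1 / \<gamma> - \<delta>\<phi>)), 2 * L_F * \<tau>,
            384 * \<tau> * M\<^sup>2 / (min 1 (\<gamma>\<^sup>2) * min \<alpha> \<tau> * \<nu> * \<alpha> * \<epsilon>\<^sup>2)}"
    by (rule mult_left_mono)
  also have "\<dots> \<le> real T"
    using \<open>real T \<ge> _\<close> unfolding A_def F_def .
  finally have Tbound: "16 * A / (min 1 (1 / \<gamma>\<^sup>2) * min \<alpha> \<tau> * \<nu> * \<epsilon>\<^sup>2) * (1 / \<eta>1) \<le> real T" .
  have avg: "1 / real T * (SX + S1) \<le> min 1 (1 / \<gamma>\<^sup>2) * (\<epsilon>\<^sup>2 / 4)"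
    by (rule average_le_accuracy[OF \<alpha>(1) \<open>0 < \<gamma>\<close> \<tau>0 \<eta>1_pos \<open>M > 0\<close> \<open>\<epsilon> > 0\<close> _ \<gamma>\<alpha> \<tau>1
          \<open>\<nu> = _\<close> \<eta>1_le(3) Tbound S bound[unfolded c_def]]) (use T0 in simp)
  have "1 / real T * S1 \<le> 1 / real T * (SX + S1)"
    using S by (intro mult_left_mono) auto
  then have "1 / real T * S1 \<le> min 1 (1 / \<gamma>\<^sup>2) * (\<epsilon>\<^sup>2 / 4)" using avg by linarith
  then have "nearly_critical (P \<Otimes>\<^sub>M uniform_count_measure {..<T}) F (\<lambda>_. 0) \<epsilon> (\<lambda>(\<omega>, t). x t \<omega>)"
    using random_iterate_nearly_critical[OF T1 \<open>\<epsilon> > 0\<close>] unfolding S1_def F_def by blast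
  moreover have "\<forall>t<T. integrable P (\<lambda>\<omega>. (norm (post_x t \<omega>))\<^sup>2) \<and> integrable P (\<lambda>\<omega>. (norm (env_grad (x t \<omega>)))\<^sup>2)"
    using gaps_square_integrable(1) env_grad_x_square_integrable by (simp add: norm_sq_integrable)
  ultimately show ?thesis
    using avg unfolding S1_def SX_def post_x_def F_def gradient_env by (simp add: sum.distrib)
qed

end
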